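(* Let $n\ge1$, $1\le m\le n$, and let $\{\tilde A_k\}_{k=1}^{2^n+1}$ be a maximal complementary set of Abelian subgroups of $\widetilde{\mathcal P}_n$ of dimension $m$ (that is, a complementary family of $2^n+1$ Abelian subgroups, each of dimension $m$). Then the (disjoint) union $\bigcup_{k=1}^{2^n+1}\tilde A_k^\circ$ is a purity invariant; precisely, for every pure state $\psi\in\mathbb{CP}^{2^n-1}$, $$I_\psi\Big(\bigcup_{k=1}^{2^n+1}\tilde A_k^\circ\Big)=2^m-1 .$$
   Context: $\widetilde{\mathcal P}_n=\{\mathbb 1,X,Y,Z\}^{\otimes n}$ is the set of the $4^n$ Hermitian $n$-qubit Pauli operators on $\mathbb C^{2^n}$, and $\mathcal P_n$ is the Pauli group they generate (phases $\pm1,\pm i$). An Abelian subgroup $A$ of $\widetilde{\mathcal P}_n$ means a commutative subgroup $A<\mathcal P_n$ with $A\subset\pm\widetilde{\mathcal P}_n$ and $-\mathbb 1\notin A$; then $A\cong\mathbb Z_2^m$ for some $0\le m\le n$, called its dimension. Signs are disregarded: $A$ is identified with the set of $P\in\widetilde{\mathcal P}_n$ such that $P\in A$ or $-P\in A$, and intersections, unions, inclusions and equalities are understood in this sense. $A^\circ:=A\setminus\{\mathbb 1\}$. Choosing independent generators $P_1,\dots,P_m$ of $A$, set $\Pi^A_x=\prod_{k=1}^m\frac{\mathbb 1+(-1)^{x_k}P_k}{2}$ and $p^A_\rho(x)=\mathrm{tr}[\Pi^A_x\rho]$ for $x\in\mathbb Z_2^m$ and $\rho$ a density operator on $\mathbb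 C^{2^n}$. The state $\rho$ is a state of maximal information in $A$ if $p^A_\rho(x)=\delta_{xx_0}$ for some $x_0$, and is unbiased in $A$ if $p^A_\rho(x)=2^{-m}$ for all $x$. Two Abelian subgroups $A,B$ are complementary if every state of maximal information in $A$ is unbiased in $B$ and every state of maximal information in $B$ is unbiased in $A$. A family $\{A_k\}_k$ is complementary if $A_k,A_l$ are complementary for all $k\neq l$. For $\mathcal S\subset\widetilde{\mathcal P}_n$ and a density operator $\rho$, $I_\rho(\mathcal S):=\sum_{P\in\mathcal S}\mathrm{tr}[P\rho]^2$; for a pure state $\psi$ one puts $\rho=|\psi\rangle\langle\psi|$. The set $\mathcal S$ is a purity invariant if $I_\psi(\mathcal S)$ is the same constant for all pure states $\psi\in\mathbb{CP}^{2^n-1}$. *)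

theory Defs
  imports
    "HOL-Library.Disjoint_Sets"
    "HOL-Algebra.Elementary_Groups"
    "HOL-Algebra.Product_Groups"
    "Jordan_Normal_Form.Schur_Decomposition"
begin

section \<open>Matrices and states\<close>

definition kron :: "'a::times mat \<Rightarrow> 'a mat \<Rightarrow> 'a mat" where
  "kron A B = mat (dim_row A * dim_row B) (dim_col A * dim_col B)
     (\<lambda>(i, j). A $$ (i div dim_row B, j div dim_col B) * B $$ (i mod dim_row B, j mod dim_col B))"

definition mat_trace :: "'a::comm_monoid_add mat \<Rightarrow> 'a" where
  "mat_trace A = (\<Sum>i<dim_row A. A $$ (i, i))"

definition density_operator :: "nat \<Rightarrow> complex mat \<Rightarrow> bool" where
  "density_operator n \<rho> \<longleftrightarrow>
     \<rho> \<in> carrier_mat (2 ^ n) (2 ^ n) \<and> mat_adjoint \<rho> = \<rho> \<and>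
     (\<forall>v \<in> carrier_vec (2 ^ n). 0 \<le> Re ((\<rho> *\<^sub>v v) \<bullet>c v)) \<and> mat_trace \<rho> = 1"

text \<open>Points of projective space are represented by unit vectors; \<open>ket_bra \<psi>\<close> depends only on the
  ray of \<open>\<psi>\<close>.\<close>

definition pure_state :: "nat \<Rightarrow> complex vec \<Rightarrow> bool" where
  "pure_state n \<psi> \<longleftrightarrow> \<psi> \<in> carrier_vec (2 ^ n) \<and> \<psi> \<bullet>c \<psi> = 1"

definition ket_bra :: "complex vec \<Rightarrow> complex mat" where
  "ket_bra \<psi> = mat (dim_vec \<psi>) (dim_vec \<psi>) (\<lambda>(i, j). \<psi> $ i * cnj (\<psi> $ j))"

section \<open>Pauli operators\<close>

definition pauli_X :: "complex mat" where
  "pauli_X = mat_of_rows_list 2 [[0, 1], [1, 0]]"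

definition pauli_Y :: "complex mat" where
  "pauli_Y = mat_of_rows_list 2 [[0, - \<i>], [\<i>, 0]]"

definition pauli_Z :: "complex mat" where
  "pauli_Z = mat_of_rows_list 2 [[1, 0], [0, - 1]]"

primrec pauli_ops :: "nat \<Rightarrow> complex mat set" where
  "pauli_ops 0 = {1\<^sub>m 1}"
| "pauli_ops (Suc n) = {kron P Q | P Q. P \<in> {1\<^sub>m 2, pauli_X, pauli_Y, pauli_Z} \<and> Q \<in> pauli_ops n}"

definition pauli_group :: "nat \<Rightarrow> complex mat monoid" where
  "pauli_group n =
     \<lparr>carrier = {c \<cdot>\<^sub>m P | c P. c \<in> {1, - 1, \<i>, - \<i>} \<and> P \<in> pauli_ops n},
      monoid.mult = (*), one = 1\<^sub>m (2 ^ n)\<rparr>"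

section \<open>Abelian subgroups\<close>

text \<open>An Abelian subgroup carries signs; \<open>unsigned n A\<close> is the set of Hermitian Pauli operators with
  which it is identified when signs are disregarded.\<close>

definition abelian_subgroup :: "nat \<Rightarrow> complex mat set \<Rightarrow> bool" where
  "abelian_subgroup n A \<longleftrightarrow>
     subgroup A (pauli_group n) \<and> (\<forall>P \<in> A. \<forall>Q \<in> A. P * Q = Q * P) \<and>
     A \<subseteq> pauli_ops n \<union> uminus ` pauli_ops n \<and> - 1\<^sub>m (2 ^ n) \<notin> A"

definition unsigned :: "nat \<Rightarrow> complex mat set \<Rightarrow> complex mat set" where
  "unsigned n A = {P \<in> pauli_ops n. P \<in> A \<or> - P \<in> A}"

definition unsigned_nontrivial :: "nat \<Rightarrow> complex mat set \<Rightarrow> complex mat set" where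
  "unsigned_nontrivial n A = unsigned n A - {1\<^sub>m (2 ^ n)}"

definition Z2_pow :: "nat \<Rightarrow> (nat \<Rightarrow> int) monoid" where
  "Z2_pow m = product_group {..<m} (\<lambda>_. integer_mod_group 2)"

definition has_dimension :: "nat \<Rightarrow> complex mat set \<Rightarrow> nat \<Rightarrow> bool" where
  "has_dimension n A m \<longleftrightarrow> (pauli_group n)\<lparr>carrier := A\<rparr> \<cong> Z2_pow m"

definition independent_generators :: "nat \<Rightarrow> complex mat set \<Rightarrow> complex mat list \<Rightarrow> bool" where
  "independent_generators n A Ps \<longleftrightarrow>
     distinct Ps \<and> set Ps \<subseteq> A \<and> generate (pauli_group n) (set Ps) = A \<and>
     (\<forall>P \<in> set Ps. P \<notin> generate (pauli_group n) (set Ps - {P}))"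

section \<open>Complementarity\<close>

definition joint_projector :: "nat \<Rightarrow> complex mat list \<Rightarrow> (nat \<Rightarrow> int) \<Rightarrow> complex mat" where
  "joint_projector n Ps x =
     foldr (*) (map (\<lambda>k. (1 / 2) \<cdot>\<^sub>m (1\<^sub>m (2 ^ n) + ((- 1) powi x k) \<cdot>\<^sub>m (Ps ! k))) [0..<length Ps])
       (1\<^sub>m (2 ^ n))"

definition outcome_prob :: "nat \<Rightarrow> complex mat list \<Rightarrow> complex mat \<Rightarrow> (nat \<Rightarrow> int) \<Rightarrow> complex" where
  "outcome_prob n Ps \<rho> x = mat_trace (joint_projector n Ps x * \<rho>)"

text \<open>Another choice of independent generators only relabels the outcomes, by an automorphism of
  \<open>Z2_pow m\<close>; hence the following two properties do not depend on the choice, and the existential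
  quantifier over \<open>Ps\<close> could equivalently be a universal one.\<close>

definition maximal_information :: "nat \<Rightarrow> complex mat set \<Rightarrow> complex mat \<Rightarrow> bool" where
  "maximal_information n A \<rho> \<longleftrightarrow>
     (\<exists>Ps. independent_generators n A Ps \<and>
        (\<exists>x0 \<in> carrier (Z2_pow (length Ps)). \<forall>x \<in> carrier (Z2_pow (length Ps)).
           outcome_prob n Ps \<rho> x = (if x = x0 then 1 else 0)))"

definition unbiased :: "nat \<Rightarrow> complex mat set \<Rightarrow> complex mat \<Rightarrow> bool" where
  "unbiased n A \<rho> \<longleftrightarrow>
     (\<exists>Ps. independent_generators n A Ps \<and>
        (\<forall>x \<in> carrier (Z2_pow (length Ps)). outcome_prob n Ps \<rho> x = 1 / 2 ^ length Ps))"

definition complementary :: "nat \<Rightarrow> complex mat set \<Rightarrow> complex mat set \<Rightarrow> bool" where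
  "complementary n A B \<longleftrightarrow>
     (\<forall>\<rho>. density_operator n \<rho> \<longrightarrow>
        (maximal_information n A \<rho> \<longrightarrow> unbiased n B \<rho>) \<and>
        (maximal_information n B \<rho> \<longrightarrow> unbiased n A \<rho>))"

definition complementary_family :: "nat \<Rightarrow> 'i set \<Rightarrow> ('i \<Rightarrow> complex mat set) \<Rightarrow> bool" where
  "complementary_family n I A \<longleftrightarrow> (\<forall>k \<in> I. \<forall>l \<in> I. k \<noteq> l \<longrightarrow> complementary n (A k) (A l))"

section \<open>Purity invariants\<close>

definition information :: "complex mat set \<Rightarrow> complex mat \<Rightarrow> complex" where
  "information S \<rho> = (\<Sum>P \<in> S. (mat_trace (P * \<rho>))\<^sup>2)"

definition purity_invariant :: "nat \<Rightarrow> complex mat set \<Rightarrow> bool" where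
  "purity_invariant n S \<longleftrightarrow>
     S \<subseteq> pauli_ops n \<and> (\<exists>c. \<forall>\<psi>. pure_state n \<psi> \<longrightarrow> information S (ket_bra \<psi>) = c)"

section \<open>Basic facts about the Pauli group\<close>

lemma kron_carrier [simp]:
  "A \<in> carrier_mat a b \<Longrightarrow> B \<in> carrier_mat c d \<Longrightarrow> kron A B \<in> carrier_mat (a * c) (b * d)"
  by (auto simp: kron_def)

lemma sum_div_mod:
  fixes f g :: "nat \<Rightarrow> 'a::semiring_0"
  assumes "0 < d"
  shows "(\<Sum>k<b * d. f (k div d) * g (k mod d)) = (\<Sum>k<b. f k) * (\<Sum>k<d. g k)"
proof -
  have "(\<Sum>k<d. f i * g k) = (\<Sum>k = i * d..<i * d + d. f (k div d) * g (k mod d))" for i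
    using assms
    by (intro sum.reindex_bij_witness[of _ "\<lambda>k. k - i * d" "\<lambda>k. i * d + k"]) auto
  then show ?thesis
    by (simp add: sum.nat_group[symmetric] sum_product)
qed

lemma mult_kron:
  fixes A B C D :: "'a::comm_semiring_0 mat"
  assumes A: "A \<in> carrier_mat a b" and C: "C \<in> carrier_mat b c"
    and B: "B \<in> carrier_mat a' b'" and D: "D \<in> carrier_mat b' c'"
    and pos: "0 < a'" "0 < b'" "0 < c'"
  shows "kron A B * kron C D = kron (A * C) (B * D)"
proof (rule eq_matI)
  fix i j
  assume "i < dim_row (kron (A * C) (B * D))" "j < dim_col (kron (A * C) (B * D))"
  then have ij: "i < a * a'" "j < c * c'" using assms by (auto simp: kron_def)
  then have d: "i div a' < a" "j div c' < c" "i mod a' < a'" "j mod c' < c'"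
    using pos by (auto simp: less_mult_imp_div_less)
  have "(kron A B * kron C D) $$ (i, j) = (\<Sum>k<b * b'.
      A $$ (i div a', k div b') * C $$ (k div b', j div c') *
      (B $$ (i mod a', k mod b') * D $$ (k mod b', j mod c')))"
    using ij assms by (auto simp: kron_def scalar_prod_def lessThan_atLeast0 mult_ac intro!: sum.cong)
  also have "\<dots> = (\<Sum>k<b. A $$ (i div a', k) * C $$ (k, j div c')) *
      (\<Sum>k<b'. B $$ (i mod a', k) * D $$ (k, j mod c'))"
    using pos by (intro sum_div_mod)
  also have "\<dots> = kron (A * C) (B * D) $$ (i, j)"
    using ij d assms by (auto simp: kron_def scalar_prod_def lessThan_atLeast0)
  finally show "(kron A B * kron C D) $$ (i, j) = kron (A * C) (B * D) $$ (i, j)" .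
qed (use assms in \<open>auto simp: kron_def\<close>)

lemma kron_one: "kron (1\<^sub>m a) (1\<^sub>m b) = (1\<^sub>m (a * b) :: 'a::comm_semiring_1 mat)"
proof (rule eq_matI)
  fix i j
  assume "i < dim_row (1\<^sub>m (a * b) :: 'a mat)" "j < dim_col (1\<^sub>m (a * b) :: 'a mat)"
  then have ij: "i < a * b" "j < a * b" by auto
  then have "0 < b" by (cases b) auto
  with ij have d: "i div b < a" "j div b < a" "i mod b < b" "j mod b < b"
    by (auto simp: less_mult_imp_div_less)
  have "i = j" if "i div b = j div b" "i mod b = j mod b"
    using that by (metis div_mult_mod_eq)
  with ij d show "kron (1\<^sub>m a) (1\<^sub>m b) $$ (i, j) = (1\<^sub>m (a * b) :: 'a mat) $$ (i, j)"
    by (auto simp: kron_def)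
qed (auto simp: kron_def)

lemma kron_smult: "kron (c \<cdot>\<^sub>m A) (d \<cdot>\<^sub>m B) = (c * d) \<cdot>\<^sub>m kron A (B :: 'a::comm_semiring_1 mat)"
proof (rule eq_matI)
  fix i j
  assume "i < dim_row ((c * d) \<cdot>\<^sub>m kron A B)" "j < dim_col ((c * d) \<cdot>\<^sub>m kron A B)"
  then have ij: "i < dim_row A * dim_row B" "j < dim_col A * dim_col B" by (auto simp: kron_def)
  then have "0 < dim_row B" "0 < dim_col B" by (cases "dim_row B"; cases "dim_col B"; simp)+
  with ij show "kron (c \<cdot>\<^sub>m A) (d \<cdot>\<^sub>m B) $$ (i, j) = ((c * d) \<cdot>\<^sub>m kron A B) $$ (i, j)"
    by (auto simp: kron_def less_mult_imp_div_less mult_ac)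
qed (auto simp: kron_def)

lemmas pauli_defs = pauli_X_def pauli_Y_def pauli_Z_def mat_of_rows_list_def

lemma pauli_single_mult:
  assumes "P \<in> {1\<^sub>m 2, pauli_X, pauli_Y, pauli_Z}" "Q \<in> {1\<^sub>m 2, pauli_X, pauli_Y, pauli_Z}"
  shows "\<exists>c \<in> {1, - 1, \<i>, - \<i>}. \<exists>R \<in> {1\<^sub>m 2, pauli_X, pauli_Y, pauli_Z}. P * Q = c \<cdot>\<^sub>m R"
proof -
  have eqs: "pauli_X * pauli_X = 1 \<cdot>\<^sub>m 1\<^sub>m 2" "pauli_Y * pauli_Y = 1 \<cdot>\<^sub>m 1\<^sub>m 2" "pauli_Z * pauli_Z = 1 \<cdot>\<^sub>m 1\<^sub>m 2"
    "pauli_X * pauli_Y = \<i> \<cdot>\<^sub>m pauli_Z" "pauli_Y * pauli_X = (- \<i>) \<cdot>\<^sub>m pauli_Z"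
    "pauli_Y * pauli_Z = \<i> \<cdot>\<^sub>m pauli_X" "pauli_Z * pauli_Y = (- \<i>) \<cdot>\<^sub>m pauli_X"
    "pauli_Z * pauli_X = \<i> \<cdot>\<^sub>m pauli_Y" "pauli_X * pauli_Z = (- \<i>) \<cdot>\<^sub>m pauli_Y"
    by (rule eq_matI; auto simp: pauli_defs scalar_prod_def less_Suc_eq numeral_2_eq_2)+
  have ids: "1\<^sub>m 2 * S = 1 \<cdot>\<^sub>m S" "S * 1\<^sub>m 2 = 1 \<cdot>\<^sub>m S"
    if "S \<in> {1\<^sub>m 2, pauli_X, pauli_Y, pauli_Z}" for S
  proof -
    have S: "S \<in> carrier_mat 2 2" using that by (auto simp: pauli_defs)
    moreover have "1 \<cdot>\<^sub>m S = S" by (intro eq_matI) auto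
    ultimately show "1\<^sub>m 2 * S = 1 \<cdot>\<^sub>m S" "S * 1\<^sub>m 2 = 1 \<cdot>\<^sub>m S" by simp_all
  qed
  show ?thesis
  proof (cases "P = 1\<^sub>m 2 \<or> Q = 1\<^sub>m 2")
    case True
    with ids assms show ?thesis by (metis insertI1)
  next
    case False
    with assms have "P \<in> {pauli_X, pauli_Y, pauli_Z}" "Q \<in> {pauli_X, pauli_Y, pauli_Z}" by auto
    with eqs show ?thesis by (elim insertE emptyE) (simp; blast)+
  qed
qed

lemma pauli_single_square:
  "P \<in> {1\<^sub>m 2, pauli_X, pauli_Y, pauli_Z} \<Longrightarrow> P * P = 1\<^sub>m 2"
  by (elim insertE emptyE)
    (auto intro!: eq_matI simp: pauli_defs scalar_prod_def less_Suc_eq numeral_2_eq_2)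

lemma pauli_single_carrier:
  "P \<in> {1\<^sub>m 2, pauli_X, pauli_Y, pauli_Z} \<Longrightarrow> P \<in> carrier_mat 2 2"
  by (auto simp: pauli_defs)

lemma pauli_ops_carrier: "P \<in> pauli_ops n \<Longrightarrow> P \<in> carrier_mat (2 ^ n) (2 ^ n)"
proof (induction n arbitrary: P)
  case (Suc n)
  then show ?case using pauli_single_carrier by (fastforce intro: kron_carrier)
qed auto

lemma one_in_pauli_ops: "1\<^sub>m (2 ^ n) \<in> pauli_ops n"
proof (induction n)
  case (Suc n)
  have "1\<^sub>m (2 ^ Suc n) = kron (1\<^sub>m 2) (1\<^sub>m (2 ^ n) :: complex mat)" by (simp add: kron_one)
  with Suc show ?case by auto
qed auto

lemma pauli_ops_mult:
  "P \<in> pauli_ops n \<Longrightarrow> Q \<in> pauli_ops n \<Longrightarrow>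
     \<exists>c \<in> {1, - 1, \<i>, - \<i>}. \<exists>R \<in> pauli_ops n. P * Q = c \<cdot>\<^sub>m R"
proof (induction n arbitrary: P Q)
  case 0
  then show ?case by (auto intro!: bexI[of _ 1] eq_matI)
next
  case (Suc n)
  obtain P1 P2 where P: "P = kron P1 P2" "P1 \<in> {1\<^sub>m 2, pauli_X, pauli_Y, pauli_Z}" "P2 \<in> pauli_ops n"
    using Suc.prems(1) by auto
  obtain Q1 Q2 where Q: "Q = kron Q1 Q2" "Q1 \<in> {1\<^sub>m 2, pauli_X, pauli_Y, pauli_Z}" "Q2 \<in> pauli_ops n"
    using Suc.prems(2) by auto
  obtain c R1 where 1: "c \<in> {1, - 1, \<i>, - \<i>}" "R1 \<in> {1\<^sub>m 2, pauli_X, pauli_Y, pauli_Z}" "P1 * Q1 = c \<cdot>\<^sub>m R1"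
    using pauli_single_mult[OF P(2) Q(2)] by blast
  obtain d R2 where 2: "d \<in> {1, - 1, \<i>, - \<i>}" "R2 \<in> pauli_ops n" "P2 * Q2 = d \<cdot>\<^sub>m R2"
    using Suc.IH[OF P(3) Q(3)] by blast
  have "P * Q = (c * d) \<cdot>\<^sub>m kron R1 R2"
    using P Q 1 2
    by (simp add: mult_kron[OF pauli_single_carrier pauli_single_carrier pauli_ops_carrier pauli_ops_carrier]
        kron_smult)
  moreover have "c * d \<in> {1, - 1, \<i>, - \<i>}" using 1(1) 2(1) by auto
  moreover have "kron R1 R2 \<in> pauli_ops (Suc n)" using 1(2) 2(2) by auto
  ultimately show ?case by blast
qed

lemma pauli_ops_square: "P \<in> pauli_ops n \<Longrightarrow> P * P = 1\<^sub>m (2 ^ n)"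
proof (induction n arbitrary: P)
  case (Suc n)
  then obtain P1 P2
    where P: "P = kron P1 P2" "P1 \<in> {1\<^sub>m 2, pauli_X, pauli_Y, pauli_Z}" "P2 \<in> pauli_ops n" by auto
  then show ?case
    using Suc.IH[OF P(3)] pauli_single_square[OF P(2)]
    by (simp add: mult_kron[OF pauli_single_carrier pauli_single_carrier pauli_ops_carrier pauli_ops_carrier]
        kron_one)
qed auto

lemma pauli_group_mult:
  assumes "P \<in> pauli_ops n" "Q \<in> pauli_ops n"
  shows "(c \<cdot>\<^sub>m P) * (d \<cdot>\<^sub>m Q) = (c * d) \<cdot>\<^sub>m (P * Q)"
  using assms[THEN pauli_ops_carrier]
  by (auto intro!: eq_matI simp: mult_smult_assoc_mat mult_smult_distrib ac_simps)

lemma group_pauli_group: "group (pauli_group n)"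
proof (rule groupI)
  show one: "\<one>\<^bsub>pauli_group n\<^esub> \<in> carrier (pauli_group n)"
    using one_in_pauli_ops[of n]
    by (auto simp: pauli_group_def intro!: exI[of _ 1] exI[of _ "1\<^sub>m (2 ^ n)"] eq_matI)
  have carr: "U \<in> carrier_mat (2 ^ n) (2 ^ n)" if "U \<in> carrier (pauli_group n)" for U
    using that pauli_ops_carrier by (auto simp: pauli_group_def)
  fix U V W
  assume U: "U \<in> carrier (pauli_group n)"
  then obtain c P where cP: "U = c \<cdot>\<^sub>m P" "c \<in> {1, - 1, \<i>, - \<i>}" "P \<in> pauli_ops n"
    by (auto simp: pauli_group_def)
  show "\<one>\<^bsub>pauli_group n\<^esub> \<otimes>\<^bsub>pauli_group n\<^esub> U = U"
    using carr[OF U] by (simp add: pauli_group_def)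
  have "inverse c \<in> {1, - 1, \<i>, - \<i>}" "c \<noteq> 0" using cP(2) by auto
  moreover have "(inverse c \<cdot>\<^sub>m P) * U = 1\<^sub>m (2 ^ n)"
    using cP(1) pauli_group_mult[OF cP(3) cP(3)] pauli_ops_square[OF cP(3)] \<open>c \<noteq> 0\<close>
    by (auto intro!: eq_matI)
  moreover have "inverse c \<cdot>\<^sub>m P \<in> carrier (pauli_group n)"
    using \<open>inverse c \<in> _\<close> cP(3) unfolding pauli_group_def partial_object.simps by blast
  ultimately show "\<exists>V \<in> carrier (pauli_group n). V \<otimes>\<^bsub>pauli_group n\<^esub> U = \<one>\<^bsub>pauli_group n\<^esub>"
    by (intro bexI[of _ "inverse c \<cdot>\<^sub>m P"]) (auto simp: pauli_group_def)
  assume V: "V \<in> carrier (pauli_group n)"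
  then obtain d Q where dQ: "V = d \<cdot>\<^sub>m Q" "d \<in> {1, - 1, \<i>, - \<i>}" "Q \<in> pauli_ops n"
    by (auto simp: pauli_group_def)
  obtain e R where eR: "e \<in> {1, - 1, \<i>, - \<i>}" "R \<in> pauli_ops n" "P * Q = e \<cdot>\<^sub>m R"
    using pauli_ops_mult[OF cP(3) dQ(3)] by blast
  have "U * V = (c * d * e) \<cdot>\<^sub>m R"
    using cP(1) dQ(1) pauli_group_mult[OF cP(3) dQ(3)] eR(3) by (auto intro!: eq_matI)
  moreover have "c * d * e \<in> {1, - 1, \<i>, - \<i>}" using cP(2) dQ(2) eR(1) by auto
  ultimately show "U \<otimes>\<^bsub>pauli_group n\<^esub> V \<in> carrier (pauli_group n)"
    using eR(2) unfolding pauli_group_def by auto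
  assume W: "W \<in> carrier (pauli_group n)"
  show "U \<otimes>\<^bsub>pauli_group n\<^esub> V \<otimes>\<^bsub>pauli_group n\<^esub> W = U \<otimes>\<^bsub>pauli_group n\<^esub> (V \<otimes>\<^bsub>pauli_group n\<^esub> W)"
    using carr[OF U] carr[OF V] carr[OF W] by (simp add: pauli_group_def assoc_mult_mat)
qed

lemma pauli_group_generated:
  assumes "1 \<le> n"
  shows "generate (pauli_group n) (pauli_ops n) = carrier (pauli_group n)"
proof
  interpret group "pauli_group n" by (rule group_pauli_group)
  have "pauli_ops n \<subseteq> carrier (pauli_group n)"
  proof
    fix P assume "P \<in> pauli_ops n"
    moreover have "P = 1 \<cdot>\<^sub>m P" by (auto intro!: eq_matI)
    ultimately show "P \<in> carrier (pauli_group n)" unfolding pauli_group_def partial_object.simps by blast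
  qed
  then show "generate (pauli_group n) (pauli_ops n) \<subseteq> carrier (pauli_group n)"
    by (rule generate_incl)
  let ?G = "generate (pauli_group n) (pauli_ops n)"
  have mult: "U * V \<in> ?G" if "U \<in> ?G" "V \<in> ?G" for U V
    using generate.eng[OF that] by (simp add: pauli_group_def)
  obtain k where n: "n = Suc k" using assms by (cases n) auto
  let ?E = "\<lambda>S. kron S (1\<^sub>m (2 ^ k)) :: complex mat"
  have E: "?E S \<in> ?G" if "S \<in> {1\<^sub>m 2, pauli_X, pauli_Y, pauli_Z}" for S
    using that one_in_pauli_ops[of k] by (intro generate.incl) (auto simp: n)
  have XYZ: "pauli_X * pauli_Y * pauli_Z = \<i> \<cdot>\<^sub>m 1\<^sub>m 2"
    by (rule eq_matI) (auto simp: pauli_defs scalar_prod_def less_Suc_eq numeral_2_eq_2)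
  have carr: "pauli_X \<in> carrier_mat 2 2" "pauli_Y \<in> carrier_mat 2 2" "pauli_Z \<in> carrier_mat 2 2"
    by (auto simp: pauli_defs)
  have "?E pauli_X * ?E pauli_Y * ?E pauli_Z = ?E (\<i> \<cdot>\<^sub>m 1\<^sub>m 2)"
    using carr by (simp add: mult_kron[of _ 2 2 _ 2 _ "2 ^ k" "2 ^ k" _ "2 ^ k"] XYZ)
  also have "\<dots> = kron (\<i> \<cdot>\<^sub>m 1\<^sub>m 2) (1 \<cdot>\<^sub>m 1\<^sub>m (2 ^ k))"
    by (rule arg_cong[where f = "kron _"]) (auto intro!: eq_matI)
  also have "\<dots> = \<i> \<cdot>\<^sub>m 1\<^sub>m (2 ^ n)"
    by (simp add: kron_smult kron_one n)
  finally have i: "\<i> \<cdot>\<^sub>m 1\<^sub>m (2 ^ n) \<in> ?G"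
    using mult[OF mult[OF E[of pauli_X] E[of pauli_Y]] E[of pauli_Z]] by simp
  have step: "(\<i> * c) \<cdot>\<^sub>m P \<in> ?G" if "c \<cdot>\<^sub>m P \<in> ?G" "P \<in> pauli_ops n" for c P
  proof -
    have "(\<i> * c) \<cdot>\<^sub>m P = \<i> \<cdot>\<^sub>m 1\<^sub>m (2 ^ n) * (c \<cdot>\<^sub>m P)"
      using pauli_group_mult[OF one_in_pauli_ops that(2)] pauli_ops_carrier[OF that(2)] by simp
    with mult[OF i that(1)] show ?thesis by simp
  qed
  show "carrier (pauli_group n) \<subseteq> ?G"
  proof
    fix U assume "U \<in> carrier (pauli_group n)"
    then obtain c P where U: "U = c \<cdot>\<^sub>m P" "c \<in> {1, - 1, \<i>, - \<i>}" "P \<in> pauli_ops n"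
      by (auto simp: pauli_group_def)
    have "1 \<cdot>\<^sub>m P = P" by (auto intro!: eq_matI)
    with U(3) have 1: "1 \<cdot>\<^sub>m P \<in> ?G" by (simp add: generate.incl)
    have 2: "\<i> \<cdot>\<^sub>m P \<in> ?G" using step[OF 1 U(3)] by simp
    have 3: "(- 1) \<cdot>\<^sub>m P \<in> ?G" using step[OF 2 U(3)] by simp
    have "(- \<i>) \<cdot>\<^sub>m P \<in> ?G" using step[OF 3 U(3)] by simp
    with 1 2 3 U show "U \<in> ?G" by auto
  qed
qed

end

theory Submission
  imports Defs
begin

text \<open>Put \<open>d = 2\<^sup>n\<close>, \<open>q = 2\<^sup>m - 1\<close>, and let \<open>S\<close> be the union. Complementarity of \<open>A\<close> and \<open>B\<close> means that
  every nontrivial \<open>Q\<close> in \<open>B\<close> anticommutes with some element of \<open>A\<close>: otherwise a joint eigenvector of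
  \<open>A\<close> and \<open>Q\<close> would be a state of maximal information in \<open>A\<close> that is biased in \<open>B\<close>. Consequently
  \<open>tr (P Q P Q)\<close> sums to \<open>0\<close> over \<open>P\<close> in \<open>A\<close>.

  The quantity to compute is the expectation in \<open>\<psi> \<otimes> \<psi>\<close> of \<open>T = \<Sum>P\<in>S. P \<otimes> P\<close>. With the flip operator
  on the tensor square, the squared Hilbert--Schmidt norm of \<open>T - q\<close> restricted to the symmetric
  subspace is a combination of the numbers \<open>tr (P Q)\<^sup>2 + tr (P Q P Q)\<close>. For \<open>d + 1\<close> complementary
  subgroups it vanishes, so \<open>T\<close> equals \<open>q\<close> on the symmetric subspace.\<close>

section \<open>A second-moment criterion\<close>

lemma mat_trace_mult:
  assumes "P \<in> carrier_mat d d" "Q \<in> carrier_mat d d"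
  shows "mat_trace (P * Q) = (\<Sum>i<d. \<Sum>j<d. P $$ (i, j) * Q $$ (j, i))"
  using assms by (auto simp: mat_trace_def scalar_prod_def lessThan_atLeast0 intro!: sum.cong)

text \<open>The hypothesis \<open>moment\<close> says that the operator \<open>\<Sum>P\<in>S. a P \<cdot> (P \<otimes> P)\<close> has Hilbert--Schmidt norm
  \<open>0\<close> on the symmetric subspace; \<open>T i j k l\<close> in the proof are its matrix entries.\<close>

lemma weighted_information_eq_0:
  fixes S :: "complex mat set" and a :: "complex mat \<Rightarrow> real"
  assumes fin: "finite S"
    and carr: "\<And>P. P \<in> S \<Longrightarrow> P \<in> carrier_mat d d"
    and herm: "\<And>P i j. P \<in> S \<Longrightarrow> i < d \<Longrightarrow> j < d \<Longrightarrow> cnj (P $$ (i, j)) = P $$ (j, i)"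
    and moment: "(\<Sum>P\<in>S. \<Sum>Q\<in>S. a P * a Q * ((mat_trace (P * Q))\<^sup>2 + mat_trace (P * Q * (P * Q)))) = 0"
    and \<psi>: "\<psi> \<in> carrier_vec d"
  shows "(\<Sum>P\<in>S. a P * (mat_trace (P * ket_bra \<psi>))\<^sup>2) = 0"
proof -
  define T where "T i j k l = (\<Sum>P\<in>S. a P * (P $$ (i, k) * P $$ (j, l)))" for i j k l
  let ?\<Sigma> = "\<lambda>f :: nat \<Rightarrow> nat \<Rightarrow> nat \<Rightarrow> nat \<Rightarrow> complex. \<Sum>i<d. \<Sum>j<d. \<Sum>k<d. \<Sum>l<d. f i j k l"
  \<comment> \<open>Exchanging the last two indices is composition with the flip of the tensor
    square; summing over all indices does not see it.\<close>
  have swap: "?\<Sigma> (\<lambda>i j k l. f i j l k) = ?\<Sigma> f" for f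
    by (intro sum.cong refl sum.swap)
  have pull: "?\<Sigma> (\<lambda>i j k l. \<Sum>P\<in>S. g P i j k l) = (\<Sum>P\<in>S. ?\<Sigma> (g P))" for g
    by (simp add: sum.swap[of _ _ S])
  \<comment> \<open>Hermiticity turns the conjugate entry of \<open>Q\<close> at
    \<open>(i, k)\<close> into the entry at \<open>(k, i)\<close>. The indices then split into the
    two cycles \<open>i k\<close> and \<open>j l\<close>, one trace for each.\<close>
  have T1: "?\<Sigma> (\<lambda>i j k l. T i j k l * cnj (T i j k l)) =
      (\<Sum>P\<in>S. \<Sum>Q\<in>S. a P * a Q * (mat_trace (P * Q))\<^sup>2)"
  proof -
    have "?\<Sigma> (\<lambda>i j k l. T i j k l * cnj (T i j k l)) = ?\<Sigma> (\<lambda>i j k l. \<Sum>P\<in>S. \<Sum>Q\<in>S.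
        a P * a Q * ((P $$ (i, k) * Q $$ (k, i)) * (P $$ (j, l) * Q $$ (l, j))))"
      by (intro sum.cong refl) (auto simp: T_def sum_product cnj_sum herm mult_ac intro!: sum.cong)
    also have "\<dots> = (\<Sum>P\<in>S. \<Sum>Q\<in>S. a P * a Q *
        ?\<Sigma> (\<lambda>i j k l. (P $$ (i, k) * Q $$ (k, i)) * (P $$ (j, l) * Q $$ (l, j))))"
      by (simp add: pull sum_distrib_left)
    also have "\<dots> = (\<Sum>P\<in>S. \<Sum>Q\<in>S. a P * a Q * (mat_trace (P * Q))\<^sup>2)"
      by (intro sum.cong refl)
        (simp add: mat_trace_mult[OF carr carr] power2_eq_square sum_product)
    finally show ?thesis .
  qed
  \<comment> \<open>With \<open>k\<close> and \<open>l\<close> exchanged in the conjugated factor,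
    the indices form the single cycle \<open>i k j l\<close>, whence one trace of a fourfold
    product.\<close>
  have T2: "?\<Sigma> (\<lambda>i j k l. T i j k l * cnj (T i j l k)) =
      (\<Sum>P\<in>S. \<Sum>Q\<in>S. a P * a Q * mat_trace (P * Q * (P * Q)))"
  proof -
    have "?\<Sigma> (\<lambda>i j k l. T i j k l * cnj (T i j l k)) = ?\<Sigma> (\<lambda>i j k l. \<Sum>P\<in>S. \<Sum>Q\<in>S.
        a P * a Q * ((P $$ (i, k) * Q $$ (k, j)) * (P $$ (j, l) * Q $$ (l, i))))"
      by (intro sum.cong refl) (auto simp: T_def sum_product cnj_sum herm mult_ac intro!: sum.cong)
    also have "\<dots> = (\<Sum>P\<in>S. \<Sum>Q\<in>S. a P * a Q *
        ?\<Sigma> (\<lambda>i j k l. (P $$ (i, k) * Q $$ (k, j)) * (P $$ (j, l) * Q $$ (l, i))))"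
      by (simp add: pull sum_distrib_left)
    also have "\<dots> = (\<Sum>P\<in>S. \<Sum>Q\<in>S. a P * a Q * mat_trace (P * Q * (P * Q)))"
    proof (intro sum.cong refl arg_cong2[where f = "(*)"])
      fix P Q assume "P \<in> S" "Q \<in> S"
      note c = carr[OF this(1)] carr[OF this(2)]
      have "(P * Q) $$ (i, j) = (\<Sum>k<d. P $$ (i, k) * Q $$ (k, j))" if "i < d" "j < d" for i j
        using c that by (auto simp: scalar_prod_def lessThan_atLeast0)
      then show "?\<Sigma> (\<lambda>i j k l. (P $$ (i, k) * Q $$ (k, j)) * (P $$ (j, l) * Q $$ (l, i))) =
          mat_trace (P * Q * (P * Q))"
        using c by (simp add: mat_trace_mult[of _ d] sum_product)
    qed
    finally show ?thesis .
  qed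
  \<comment> \<open>\<open>T i j k l + T i j l k\<close> is an entry of the operator composed with
    identity plus flip, which is twice the projection onto the symmetric subspace. Expanding the
    squared modulus gives the sums in \<open>T1\<close> and \<open>T2\<close> twice each, so
    \<open>moment\<close> makes the total 0.\<close>
  let ?N = "\<lambda>i j k l. (cmod (T i j k l + T i j l k))\<^sup>2"
  have "complex_of_real (\<Sum>i<d. \<Sum>j<d. \<Sum>k<d. \<Sum>l<d. ?N i j k l) =
      ?\<Sigma> (\<lambda>i j k l. T i j k l * cnj (T i j k l) + T i j k l * cnj (T i j l k)) +
      ?\<Sigma> (\<lambda>i j k l. T i j l k * cnj (T i j l k) + T i j l k * cnj (T i j k l))"
    by (simp only: of_real_sum complex_norm_square sum.distrib[symmetric]) (simp add: algebra_simps)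
  also have "\<dots> = 2 * ?\<Sigma> (\<lambda>i j k l. T i j k l * cnj (T i j k l) + T i j k l * cnj (T i j l k))"
    using swap[of "\<lambda>i j k l. T i j k l * cnj (T i j k l) + T i j k l * cnj (T i j l k)"] by simp
  also have "\<dots> = 0"
    using moment by (simp only: sum.distrib T1 T2 distrib_left)  simp
  finally have "(\<Sum>i<d. \<Sum>j<d. \<Sum>k<d. \<Sum>l<d. ?N i j k l) = 0"
    by (simp only: of_real_eq_0_iff)
  then have anti: "T i j k l + T i j l k = 0" if "i < d" "j < d" "k < d" "l < d" for i j k l
    using that by (simp add: sum_nonneg_eq_0_iff sum_nonneg)
  let ?v = "\<lambda>i j k l. cnj (\<psi> $ i) * cnj (\<psi> $ j) * (\<psi> $ k * \<psi> $ l)"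
  have tr: "mat_trace (P * ket_bra \<psi>) = (\<Sum>i<d. \<Sum>k<d. P $$ (i, k) * (\<psi> $ k * cnj (\<psi> $ i)))"
    if "P \<in> S" for P
    using mat_trace_mult[OF carr[OF that], of "ket_bra \<psi>"] \<psi> by (simp add: ket_bra_def)
  have I: "(\<Sum>P\<in>S. a P * (mat_trace (P * ket_bra \<psi>))\<^sup>2) = ?\<Sigma> (\<lambda>i j k l. ?v i j k l * T i j k l)"
  proof -
    have "(\<Sum>P\<in>S. a P * (mat_trace (P * ket_bra \<psi>))\<^sup>2) =
        (\<Sum>P\<in>S. ?\<Sigma> (\<lambda>i j k l. a P * (?v i j k l * (P $$ (i, k) * P $$ (j, l)))))"
    proof (rule sum.cong[OF refl])
      fix P assume "P \<in> S"
      then have "(mat_trace (P * ket_bra \<psi>))\<^sup>2 =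
          ?\<Sigma> (\<lambda>i j k l. P $$ (i, k) * (\<psi> $ k * cnj (\<psi> $ i)) * (P $$ (j, l) * (\<psi> $ l * cnj (\<psi> $ j))))"
        by (simp only: tr power2_eq_square sum_product)
      then show "a P * (mat_trace (P * ket_bra \<psi>))\<^sup>2 =
          ?\<Sigma> (\<lambda>i j k l. a P * (?v i j k l * (P $$ (i, k) * P $$ (j, l))))"
        by (simp add: sum_distrib_left mult_ac)
    qed
    also have "\<dots> = ?\<Sigma> (\<lambda>i j k l. ?v i j k l * T i j k l)"
      by (simp add: pull[symmetric] T_def sum_distrib_left mult_ac)
    finally show ?thesis .
  qed
  \<comment> \<open>The weights \<open>?v\<close> are the coefficients of \<psi> \<otimes> \<psi>
    and its conjugate, hence symmetric in \<open>k\<close> and \<open>l\<close>, whereas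
    \<open>anti\<close> makes \<open>T\<close> antisymmetric there. Twice the pairing is therefore
    0.\<close>
  have "?\<Sigma> (\<lambda>i j k l. ?v i j k l * T i j k l) + ?\<Sigma> (\<lambda>i j k l. ?v i j k l * T i j l k) =
      ?\<Sigma> (\<lambda>i j k l. ?v i j k l * (T i j k l + T i j l k))"
    by (simp only: sum.distrib distrib_left)
  also have "\<dots> = 0"
    by (intro sum.neutral ballI) (simp add: anti)
  finally have "?\<Sigma> (\<lambda>i j k l. ?v i j k l * T i j k l) + ?\<Sigma> (\<lambda>i j k l. ?v i j k l * T i j l k) = 0" .
  moreover have "?\<Sigma> (\<lambda>i j k l. ?v i j k l * T i j l k) = ?\<Sigma> (\<lambda>i j k l. ?v i j k l * T i j k l)"
    using swap[of "\<lambda>i j k l. ?v i j k l * T i j k l"] by (simp add: mult_ac)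
  ultimately show ?thesis using I by simp
qed

section \<open>Pauli operators\<close>

lemma mat_trace_kron:
  fixes A B :: "complex mat"
  assumes "A \<in> carrier_mat a a" "B \<in> carrier_mat b b" "0 < b"
  shows "mat_trace (kron A B) = mat_trace A * mat_trace B"
  using assms sum_div_mod[of b "\<lambda>i. A $$ (i, i)" "\<lambda>i. B $$ (i, i)" a]
  by (simp add: mat_trace_def kron_def)

lemma pauli_single_hermitian:
  "P \<in> {1\<^sub>m 2, pauli_X, pauli_Y, pauli_Z} \<Longrightarrow> i < 2 \<Longrightarrow> j < 2 \<Longrightarrow> cnj (P $$ (i, j)) = P $$ (j, i)"
  by (elim insertE emptyE) (auto simp: pauli_defs less_Suc_eq numeral_2_eq_2)

lemma pauli_single_trace:
  assumes "P \<in> {1\<^sub>m 2, pauli_X, pauli_Y, pauli_Z}" "Q \<in> {1\<^sub>m 2, pauli_X, pauli_Y, pauli_Z}"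
  shows "mat_trace (P * Q) = (if P = Q then 2 else 0)"
proof (cases "P = Q")
  case True
  with pauli_single_square[OF assms(2)] show ?thesis by (simp add: mat_trace_def)
next
  case False
  with assms have "mat_trace (P * Q) = 0"
    unfolding mat_trace_mult[OF assms[THEN pauli_single_carrier]]
    by (elim insertE emptyE) (auto simp: pauli_defs numeral_2_eq_2)
  with False show ?thesis by simp
qed

lemma pauli_single_commute:
  assumes "P \<in> {1\<^sub>m 2, pauli_X, pauli_Y, pauli_Z}" "Q \<in> {1\<^sub>m 2, pauli_X, pauli_Y, pauli_Z}"
  shows "\<exists>s \<in> {1, - 1}. P * Q = s \<cdot>\<^sub>m (Q * P)"
proof -
  have "P * Q = 1 \<cdot>\<^sub>m (Q * P) \<or> P * Q = (- 1) \<cdot>\<^sub>m (Q * P)"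
    using assms
    by (elim insertE emptyE)
      (auto simp: mat_eq_iff pauli_defs scalar_prod_def less_Suc_eq numeral_2_eq_2)
  then show ?thesis by blast
qed

lemma pauli_ops_hermitian:
  "P \<in> pauli_ops n \<Longrightarrow> i < 2 ^ n \<Longrightarrow> j < 2 ^ n \<Longrightarrow> cnj (P $$ (i, j)) = P $$ (j, i)"
proof (induction n arbitrary: P i j)
  case (Suc n)
  then obtain R Q where P: "P = kron R Q" "R \<in> {1\<^sub>m 2, pauli_X, pauli_Y, pauli_Z}" "Q \<in> pauli_ops n"
    by auto
  note c = pauli_single_carrier[OF P(2)] pauli_ops_carrier[OF P(3)]
  have d: "i div 2 ^ n < 2" "j div 2 ^ n < 2" "i mod 2 ^ n < 2 ^ n" "j mod 2 ^ n < 2 ^ n"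
    using Suc.prems by (auto simp: less_mult_imp_div_less)
  show ?case
    using c Suc.prems(2,3) pauli_single_hermitian[OF P(2) d(1,2)] Suc.IH[OF P(3) d(3,4)]
    by (simp add: P(1) kron_def)
qed auto

text \<open>The trace is multiplicative over tensor factors, and distinct products differ in at
  least one factor, which contributes 0. Equal operators multiply to the identity.\<close>

lemma pauli_ops_trace:
  "P \<in> pauli_ops n \<Longrightarrow> Q \<in> pauli_ops n \<Longrightarrow> mat_trace (P * Q) = (if P = Q then 2 ^ n else 0)"
proof (induction n arbitrary: P Q)
  case 0
  then show ?case by (simp add: mat_trace_def)
next
  case (Suc n)
  obtain P1 P2 where P: "P = kron P1 P2" "P1 \<in> {1\<^sub>m 2, pauli_X, pauli_Y, pauli_Z}" "P2 \<in> pauli_ops n"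
    using Suc.prems(1) by auto
  obtain Q1 Q2 where Q: "Q = kron Q1 Q2" "Q1 \<in> {1\<^sub>m 2, pauli_X, pauli_Y, pauli_Z}" "Q2 \<in> pauli_ops n"
    using Suc.prems(2) by auto
  note c = pauli_single_carrier[OF P(2)] pauli_single_carrier[OF Q(2)]
    pauli_ops_carrier[OF P(3)] pauli_ops_carrier[OF Q(3)]
  show ?case
  proof (cases "P = Q")
    case True
    then show ?thesis using pauli_ops_square[OF Suc.prems(2)] by (simp add: mat_trace_def)
  next
    case False
    then have "P1 \<noteq> Q1 \<or> P2 \<noteq> Q2" using P(1) Q(1) by auto
    moreover have "mat_trace (P * Q) = mat_trace (P1 * Q1) * mat_trace (P2 * Q2)"
      using c by (simp add: P(1) Q(1) mult_kron[OF c] mat_trace_kron[of _ 2 _ "2 ^ n"])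
    ultimately show ?thesis
      using False pauli_single_trace[OF P(2) Q(2)] Suc.IH[OF P(3) Q(3)] by auto
  qed
qed

text \<open>Each tensor position contributes a sign, and these signs multiply.\<close>

lemma pauli_ops_commute:
  "P \<in> pauli_ops n \<Longrightarrow> Q \<in> pauli_ops n \<Longrightarrow> \<exists>s \<in> {1, - 1}. P * Q = s \<cdot>\<^sub>m (Q * P)"
proof (induction n arbitrary: P Q)
  case 0
  then show ?case by (auto intro!: bexI[of _ 1] eq_matI)
next
  case (Suc n)
  obtain P1 P2 where P: "P = kron P1 P2" "P1 \<in> {1\<^sub>m 2, pauli_X, pauli_Y, pauli_Z}" "P2 \<in> pauli_ops n"
    using Suc.prems(1) by auto
  obtain Q1 Q2 where Q: "Q = kron Q1 Q2" "Q1 \<in> {1\<^sub>m 2, pauli_X, pauli_Y, pauli_Z}" "Q2 \<in> pauli_ops n"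
    using Suc.prems(2) by auto
  obtain s t where s: "s \<in> {1, - 1}" "P1 * Q1 = s \<cdot>\<^sub>m (Q1 * P1)"
    and t: "t \<in> {1, - 1}" "P2 * Q2 = t \<cdot>\<^sub>m (Q2 * P2)"
    using pauli_single_commute[OF P(2) Q(2)] Suc.IH[OF P(3) Q(3)] by blast
  note c = pauli_single_carrier[OF P(2)] pauli_single_carrier[OF Q(2)]
    pauli_ops_carrier[OF P(3)] pauli_ops_carrier[OF Q(3)]
  have "P * Q = (s * t) \<cdot>\<^sub>m (Q * P)"
    using c s t by (simp add: P(1) Q(1) mult_kron[OF c] mult_kron[OF c(2,1,4,3)] kron_smult)
  moreover have "s * t \<in> {1, - 1}" using s t by auto
  ultimately show ?case by blast
qed

lemma finite_pauli_ops: "finite (pauli_ops n)"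
proof (induction n)
  case (Suc n)
  have "pauli_ops (Suc n) \<subseteq> (\<lambda>(P, Q). kron P Q) ` ({1\<^sub>m 2, pauli_X, pauli_Y, pauli_Z} \<times> pauli_ops n)"
    by auto
  with Suc show ?case using finite_subset by blast
qed auto

section \<open>Joint eigenvectors and outcome probabilities\<close>

lemma smult_one_vec [simp]: "(1 :: 'a :: monoid_mult) \<cdot>\<^sub>v v = v"
  by (intro eq_vecI) auto

text \<open>The last conjunct lets the eigenvector be found in a prescribed eigenspace of any operator that
  commutes with \<open>F\<close>: \<open>w\<close> is obtained from \<open>v\<close> by repeatedly replacing it with \<open>v + U v\<close>.\<close>

lemma joint_eigenvector:
  fixes F :: "complex mat set"
  assumes "finite F" "F \<subseteq> carrier_mat d d" "\<And>U. U \<in> F \<Longrightarrow> U * U = 1\<^sub>m d"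
    and "\<And>U V. U \<in> F \<Longrightarrow> V \<in> F \<Longrightarrow> U * V = V * U"
    and v: "v \<in> carrier_vec d" "v \<noteq> 0\<^sub>v d"
  shows "\<exists>w \<in> carrier_vec d. w \<noteq> 0\<^sub>v d \<and> (\<forall>U \<in> F. \<exists>s \<in> {1, - 1}. U *\<^sub>v w = s \<cdot>\<^sub>v w) \<and>
    (\<forall>Q \<in> carrier_mat d d. \<forall>c. (\<forall>U \<in> F. U * Q = Q * U) \<longrightarrow> Q *\<^sub>v v = c \<cdot>\<^sub>v v \<longrightarrow> Q *\<^sub>v w = c \<cdot>\<^sub>v w)"
  using assms(1-4)
proof (induction rule: finite_induct)
  case empty
  show ?case by (rule bexI[of _ v]) (use v in auto)
next
  case (insert U F)
  note comm = insert.prems(3)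
  have "F \<subseteq> carrier_mat d d" and U: "U \<in> carrier_mat d d" using insert.prems(1) by auto
  from insert.IH[OF this(1) insert.prems(2) comm] obtain w
    where w: "w \<in> carrier_vec d" "w \<noteq> 0\<^sub>v d"
      and ev: "\<And>V. V \<in> F \<Longrightarrow> \<exists>s \<in> {1, - 1}. V *\<^sub>v w = s \<cdot>\<^sub>v w"
      and Q: "\<And>Q c. Q \<in> carrier_mat d d \<Longrightarrow> \<forall>U \<in> F. U * Q = Q * U \<Longrightarrow> Q *\<^sub>v v = c \<cdot>\<^sub>v v \<Longrightarrow> Q *\<^sub>v w = c \<cdot>\<^sub>v w"
    by auto
  have Uw: "U *\<^sub>v w \<in> carrier_vec d" using U w by auto
  show ?case
  proof (cases "w + U *\<^sub>v w = 0\<^sub>v d")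
    case True
    \<comment> \<open>Here \<open>w\<close> is already an eigenvector of \<open>U\<close>, with
      eigenvalue \<open>- 1\<close>, and can be kept.\<close>
    have "U *\<^sub>v w = (- 1) \<cdot>\<^sub>v w"
    proof (rule eq_vecI)
      fix i assume "i < dim_vec ((- 1) \<cdot>\<^sub>v w)"
      then have "i < d" using w by simp
      then have "(w + U *\<^sub>v w) $ i = 0" by (simp add: True)
      then show "(U *\<^sub>v w) $ i = ((- 1) \<cdot>\<^sub>v w) $ i"
        using \<open>i < d\<close> w U by (simp add: add_eq_0_iff del: index_mult_mat_vec)
    qed (use U w in auto)
    with w ev Q show ?thesis by (intro bexI[of _ w]) auto
  next
    case False
    \<comment> \<open>By \<open>U * U = 1\<close> the new vector is fixed by \<open>U\<close>. The
      fact \<open>step\<close> below shows that every eigenvalue equation at \<open>w\<close> of an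
      operator commuting with \<open>U\<close> survives the replacement; it serves both the earlier
      members of \<open>F\<close> and the operators \<open>Q\<close> of the last conjunct.\<close>
    let ?w = "w + U *\<^sub>v w"
    have w': "?w \<in> carrier_vec d" using w Uw by simp
    have step: "Q *\<^sub>v ?w = c \<cdot>\<^sub>v ?w" if "Q \<in> carrier_mat d d" "Q *\<^sub>v w = c \<cdot>\<^sub>v w" "U * Q = Q * U" for Q c
    proof -
      have "Q *\<^sub>v (U *\<^sub>v w) = (Q * U) *\<^sub>v w" using that U w by simp
      also have "\<dots> = U *\<^sub>v (Q *\<^sub>v w)" using that U w by (simp flip: that(3))
      also have "\<dots> = c \<cdot>\<^sub>v (U *\<^sub>v w)" using that U w by (simp add: mult_mat_vec)
      finally show ?thesis
        using that w Uw by (simp add: mult_add_distrib_mat_vec smult_add_distrib_vec)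
    qed
    have "U *\<^sub>v (U *\<^sub>v w) = w"
      using U w insert.prems(2)[of U] by (simp flip: assoc_mult_mat_vec)
    then have "U *\<^sub>v ?w = 1 \<cdot>\<^sub>v ?w"
      using U w Uw comm_add_vec[OF w(1) Uw] by (simp add: mult_add_distrib_mat_vec)
    moreover have "\<exists>s \<in> {1, - 1}. V *\<^sub>v ?w = s \<cdot>\<^sub>v ?w" if "V \<in> F" for V
      using ev[OF that] step[of V] that comm[of U V] insert.prems(1) by blast
    moreover have "Q *\<^sub>v ?w = c \<cdot>\<^sub>v ?w"
      if "Q \<in> carrier_mat d d" "\<forall>V \<in> insert U F. V * Q = Q * V" "Q *\<^sub>v v = c \<cdot>\<^sub>v v" for Q c
      using step Q that by simp
    ultimately show ?thesis using False w' by (intro bexI[of _ ?w]) blast+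
  qed
qed

section \<open>Joint projectors as products of commuting factors\<close>

lemma foldr_mult_carrier:
  "set Fs \<subseteq> carrier_mat d d \<Longrightarrow> foldr (*) Fs (1\<^sub>m d) \<in> carrier_mat d d"
  by (induction Fs) auto

lemma foldr_mult_commute:
  fixes Q :: "complex mat"
  assumes "Q \<in> carrier_mat d d" "set Fs \<subseteq> carrier_mat d d" "\<And>F. F \<in> set Fs \<Longrightarrow> Q * F = F * Q"
  shows "Q * foldr (*) Fs (1\<^sub>m d) = foldr (*) Fs (1\<^sub>m d) * Q"
  using assms(2,3)
proof (induction Fs)
  case Nil
  then show ?case using assms(1) by simp
next
  case (Cons F Fs)
  let ?M = "foldr (*) Fs (1\<^sub>m d)"
  have c: "F \<in> carrier_mat d d" "?M \<in> carrier_mat d d"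
    using Cons.prems(1) by (auto intro: foldr_mult_carrier)
  have "Q * (F * ?M) = F * Q * ?M"
    using c assms(1) Cons.prems(2)[of F] by (simp flip: assoc_mult_mat)
  also have "\<dots> = F * (?M * Q)"
    using c assms(1) Cons by simp
  finally show ?case using c assms(1) by simp
qed

text \<open>\<open>Q\<close> moves past the factors in front of \<open>F0\<close> and is turned into
  the scalar \<open>c\<close> there.\<close>

lemma foldr_mult_absorb:
  fixes Q :: "complex mat"
  assumes "Q \<in> carrier_mat d d" "set Fs \<subseteq> carrier_mat d d" "\<And>F. F \<in> set Fs \<Longrightarrow> Q * F = F * Q"
    and "F0 \<in> set Fs" "Q * F0 = c \<cdot>\<^sub>m F0"
  shows "Q * foldr (*) Fs (1\<^sub>m d) = c \<cdot>\<^sub>m foldr (*) Fs (1\<^sub>m d)"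
  using assms(2-4)
proof (induction Fs)
  case (Cons F Fs)
  let ?M = "foldr (*) Fs (1\<^sub>m d)"
  have M: "F \<in> carrier_mat d d" "?M \<in> carrier_mat d d"
    using Cons.prems(1) by (auto intro: foldr_mult_carrier)
  show ?case
  proof (cases "F = F0")
    case True
    then show ?thesis
      using M assms(1,5) by (simp add: mult_smult_assoc_mat[of _ d d _ d] flip: assoc_mult_mat)
  next
    case False
    have "Q * (F * ?M) = F * Q * ?M"
      using M assms(1) Cons.prems(2)[of F] by (simp flip: assoc_mult_mat)
    also have "\<dots> = F * (c \<cdot>\<^sub>m ?M)"
      using M assms(1) Cons False by simp
    finally show ?thesis using M by (simp add: mult_smult_distrib[of _ d d _ d])
  qed
qed simp

lemma foldr_mult_eigenvector:
  fixes v :: "complex vec"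
  assumes "v \<in> carrier_vec d"
    and "\<And>k. k \<in> set ks \<Longrightarrow> f k \<in> carrier_mat d d \<and> f k *\<^sub>v v = e k \<cdot>\<^sub>v v"
  shows "foldr (*) (map f ks) (1\<^sub>m d) *\<^sub>v v = prod_list (map e ks) \<cdot>\<^sub>v v"
  using assms(2)
proof (induction ks)
  case Nil
  then show ?case using assms(1) by simp
next
  case (Cons k ks)
  let ?M = "foldr (*) (map f ks) (1\<^sub>m d)"
  have M: "?M \<in> carrier_mat d d" and k: "f k \<in> carrier_mat d d" "f k *\<^sub>v v = e k \<cdot>\<^sub>v v"
    using Cons.prems by (auto intro!: foldr_mult_carrier)
  have IH: "?M *\<^sub>v v = prod_list (map e ks) \<cdot>\<^sub>v v" using Cons by simp
  have "f k *\<^sub>v (?M *\<^sub>v v) = prod_list (map e ks) \<cdot>\<^sub>v (e k \<cdot>\<^sub>v v)"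
    using k assms(1) by (simp add: IH mult_mat_vec)
  then show ?case
    using k M assms(1) by (simp add: smult_smult_assoc mult.commute assoc_mult_mat_vec[of _ d d _ d])
qed

lemma carrier_Z2_pow: "carrier (Z2_pow m) = {..<m} \<rightarrow>\<^sub>E {0, 1}"
proof -
  have "{0..<2} = {0, 1 :: int}" by auto
  then show ?thesis by (simp add: Z2_pow_def carrier_integer_mod_group)
qed

lemma Z2_powD: "x \<in> carrier (Z2_pow m) \<Longrightarrow> k < m \<Longrightarrow> x k \<in> {0, 1}"
  by (auto simp: carrier_Z2_pow)

lemma smult_mult_mat_vec:
  fixes A :: "'a :: comm_ring mat"
  assumes "A \<in> carrier_mat r d" "v \<in> carrier_vec d"
  shows "(c \<cdot>\<^sub>m A) *\<^sub>v v = c \<cdot>\<^sub>v (A *\<^sub>v v)"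
  using assms by (intro eq_vecI) auto

lemma joint_projector_factor_eigenvector:
  fixes P :: "complex mat"
  assumes "P \<in> carrier_mat d d" "v \<in> carrier_vec d" "P *\<^sub>v v = s \<cdot>\<^sub>v v"
  shows "(1 / 2) \<cdot>\<^sub>m (1\<^sub>m d + c \<cdot>\<^sub>m P) *\<^sub>v v = ((1 + c * s) / 2) \<cdot>\<^sub>v v"
proof -
  have "c \<cdot>\<^sub>m P *\<^sub>v v = (c * s) \<cdot>\<^sub>v v"
    using assms by (simp add: smult_mult_mat_vec[of _ d d] smult_smult_assoc)
  then have "(1\<^sub>m d + c \<cdot>\<^sub>m P) *\<^sub>v v = (1 + c * s) \<cdot>\<^sub>v v"
    using assms by (simp add: add_mult_distrib_mat_vec[of _ d d] add_smult_distrib_vec)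
  then show ?thesis
    using assms by (simp add: smult_mult_mat_vec[of _ d d] smult_smult_assoc)
qed

text \<open>On an eigenvector with signs given by \<open>y\<close>, the factor with index
  \<open>k\<close> acts as 1 if \<open>x k = y k\<close> and as 0 otherwise, so only the projector
  of the label \<open>y\<close> itself survives.\<close>

lemma joint_projector_eigenvector:
  assumes "set Ps \<subseteq> carrier_mat (2 ^ n) (2 ^ n)" "v \<in> carrier_vec (2 ^ n)"
    and x: "x \<in> carrier (Z2_pow (length Ps))" and y: "y \<in> carrier (Z2_pow (length Ps))"
    and ev: "\<And>k. k < length Ps \<Longrightarrow> Ps ! k *\<^sub>v v = ((- 1) powi y k) \<cdot>\<^sub>v v"
  shows "joint_projector n Ps x *\<^sub>v v = (if x = y then 1 else 0) \<cdot>\<^sub>v v"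
proof -
  let ?e = "\<lambda>k. (if x k = y k then 1 else 0 :: complex)"
  have e: "(1 + (- 1) powi x k * (- 1) powi y k) / 2 = ?e k" if "k < length Ps" for k
    using Z2_powD[OF x that] Z2_powD[OF y that] by auto
  have "joint_projector n Ps x *\<^sub>v v = prod_list (map ?e [0..<length Ps]) \<cdot>\<^sub>v v"
    unfolding joint_projector_def
    by (intro foldr_mult_eigenvector conjI assms(2))
      (use assms(1) in \<open>auto simp: joint_projector_factor_eigenvector[OF _ assms(2) ev] e subset_iff\<close>)
  also have "prod_list (map ?e [0..<length Ps]) = (\<Prod>k<length Ps. ?e k)"
    by (simp add: prod.list_conv_set_nth lessThan_atLeast0)
  also have "\<dots> = (if x = y then 1 else 0)"
  proof (cases "x = y")
    case False
    \<comment> \<open>Labels are extensional functions on \<open>{..<length Ps}\<close>, so two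
      different ones differ at an index below the length, and the factor there is 0.\<close>
    then obtain k where "k < length Ps" "x k \<noteq> y k"
      using x y unfolding carrier_Z2_pow by (metis PiE_ext lessThan_iff)
    then show ?thesis using False by (auto intro!: prod_zero)
  qed simp
  finally show ?thesis .
qed

lemma joint_projector_carrier:
  "set Ps \<subseteq> carrier_mat (2 ^ n) (2 ^ n) \<Longrightarrow> joint_projector n Ps x \<in> carrier_mat (2 ^ n) (2 ^ n)"
  unfolding joint_projector_def by (intro foldr_mult_carrier) (auto simp: subset_iff)

lemma joint_projector_factor_commute:
  fixes P Q :: "complex mat"
  assumes "P \<in> carrier_mat d d" "Q \<in> carrier_mat d d" "Q * P = P * Q"
  shows "Q * ((1 / 2) \<cdot>\<^sub>m (1\<^sub>m d + c \<cdot>\<^sub>m P)) = (1 / 2) \<cdot>\<^sub>m (1\<^sub>m d + c \<cdot>\<^sub>m P) * Q"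
  using assms
  by (simp add: mult_smult_distrib[of _ d d _ d] mult_smult_assoc_mat[of _ d d _ d]
      mult_add_distrib_mat[of _ d d _ d] add_mult_distrib_mat[of _ d d _ _ d])

lemma joint_projector_commute:
  assumes "set Ps \<subseteq> carrier_mat (2 ^ n) (2 ^ n)" "Q \<in> carrier_mat (2 ^ n) (2 ^ n)"
    and "\<And>P. P \<in> set Ps \<Longrightarrow> Q * P = P * Q"
  shows "Q * joint_projector n Ps x = joint_projector n Ps x * Q"
  unfolding joint_projector_def using assms
  by (intro foldr_mult_commute) (auto simp: subset_iff intro!: joint_projector_factor_commute)

text \<open>With \<open>s\<close> the sign of outcome \<open>x k\<close> and \<open>P\<close> the
  generator \<open>Ps ! k\<close>, \<open>P * P = 1\<close> and \<open>s * s = 1\<close> give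
  \<open>P (1 + s P) = s (1 + s P)\<close>. Hence \<open>P\<close> is absorbed by its own factor and
  commutes with the others; the range of the projector consists of joint eigenvectors.\<close>

lemma joint_projector_absorb:
  assumes c: "set Ps \<subseteq> carrier_mat (2 ^ n) (2 ^ n)"
    and comm: "\<And>P Q. P \<in> set Ps \<Longrightarrow> Q \<in> set Ps \<Longrightarrow> Q * P = P * Q"
    and sq: "\<And>P. P \<in> set Ps \<Longrightarrow> P * P = 1\<^sub>m (2 ^ n)"
    and x: "x \<in> carrier (Z2_pow (length Ps))" and k: "k < length Ps"
  shows "Ps ! k * joint_projector n Ps x = ((- 1) powi x k) \<cdot>\<^sub>m joint_projector n Ps x"
proof -
  let ?d = "2 ^ n" and ?P = "Ps ! k" and ?s = "(- 1) powi x k :: complex"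
  let ?F = "(1 / 2) \<cdot>\<^sub>m (1\<^sub>m (2 ^ n) + ?s \<cdot>\<^sub>m ?P)"
  have P: "?P \<in> set Ps" "?P \<in> carrier_mat (2 ^ n) (2 ^ n)" using c k by auto
  have "?P * ?F = (1 / 2) \<cdot>\<^sub>m (?P + ?s \<cdot>\<^sub>m 1\<^sub>m (2 ^ n))"
    using P sq[OF P(1)] by (simp add: mult_smult_distrib[of _ ?d ?d _ ?d] mult_add_distrib_mat[of _ ?d ?d _ ?d])
  also have "\<dots> = ?s \<cdot>\<^sub>m ?F"
    using Z2_powD[OF x k] P by (intro eq_matI) auto
  finally have "?P * ?F = ?s \<cdot>\<^sub>m ?F" .
  then show ?thesis
    unfolding joint_projector_def using c P k comm
    by (intro foldr_mult_absorb[of _ _ _ ?F]) (auto simp: subset_iff intro!: joint_projector_factor_commute)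
qed

section \<open>Pure states and their outcome distributions\<close>

lemma mat_trace_ket_bra:
  assumes "M \<in> carrier_mat d d" "v \<in> carrier_vec d"
  shows "mat_trace (M * ket_bra v) = (M *\<^sub>v v) \<bullet>c v"
proof -
  have "ket_bra v \<in> carrier_mat d d" using assms by (auto simp: ket_bra_def)
  from mat_trace_mult[OF assms(1) this] show ?thesis
    using assms by (simp add: ket_bra_def scalar_prod_def lessThan_atLeast0 sum_distrib_left mult_ac)
qed

lemma outcome_prob_ket_bra:
  assumes "set Ps \<subseteq> carrier_mat (2 ^ n) (2 ^ n)" "v \<in> carrier_vec (2 ^ n)"
  shows "outcome_prob n Ps (ket_bra v) x = (joint_projector n Ps x *\<^sub>v v) \<bullet>c v"
  unfolding outcome_prob_def
  using mat_trace_ket_bra[OF joint_projector_carrier[OF assms(1)] assms(2)] .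

text \<open>Positivity holds because the quadratic form at \<open>w\<close> is the squared modulus
  of the inner product of \<open>v\<close> and \<open>w\<close>.\<close>

lemma density_operator_ket_bra:
  assumes "pure_state n v"
  shows "density_operator n (ket_bra v)"
proof -
  have v: "v \<in> carrier_vec (2 ^ n)" "v \<bullet>c v = 1" using assms by (auto simp: pure_state_def)
  then have c: "ket_bra v \<in> carrier_mat (2 ^ n) (2 ^ n)" by (auto simp: ket_bra_def)
  have "mat_adjoint (ket_bra v) = ket_bra v"
    by (intro eq_matI) (auto simp: mat_adjoint_def mat_of_rows_index ket_bra_def)
  moreover have "mat_trace (ket_bra v) = 1"
    using v mat_trace_ket_bra[of "1\<^sub>m (2 ^ n)" "2 ^ n" v] c by simp
  moreover have "0 \<le> Re ((ket_bra v *\<^sub>v w) \<bullet>c w)" if w: "w \<in> carrier_vec (2 ^ n)" for w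
  proof -
    have "(ket_bra v *\<^sub>v w) \<bullet>c w = (v \<bullet>c w) * cnj (v \<bullet>c w)"
      using v(1) w
      by (simp add: ket_bra_def scalar_prod_def sum_distrib_right sum_distrib_left mult_ac)
        (rule sum.swap)
    also have "\<dots> = complex_of_real ((cmod (v \<bullet>c w))\<^sup>2)"
      by (rule complex_norm_square[symmetric])
    finally show ?thesis by simp
  qed
  ultimately show ?thesis using c by (simp add: density_operator_def)
qed

lemma exists_outcome_label:
  assumes "\<And>k. k < length Ps \<Longrightarrow> \<exists>s \<in> {1, - 1 :: complex}. Ps ! k *\<^sub>v v = s \<cdot>\<^sub>v v"
  shows "\<exists>x \<in> carrier (Z2_pow (length Ps)). \<forall>k < length Ps. Ps ! k *\<^sub>v v = ((- 1) powi x k) \<cdot>\<^sub>v v"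
proof -
  \<comment> \<open>Sign 1 becomes 0 and sign \<open>- 1\<close> becomes 1. The restriction to
    \<open>{..<length Ps}\<close> makes the label extensional, as membership in
    \<open>Z2_pow\<close> requires.\<close>
  let ?x = "\<lambda>k \<in> {..<length Ps}. if Ps ! k *\<^sub>v v = 1 \<cdot>\<^sub>v v then 0 else 1 :: int"
  have "?x \<in> carrier (Z2_pow (length Ps))" by (auto simp: carrier_Z2_pow)
  moreover have "Ps ! k *\<^sub>v v = ((- 1) powi ?x k) \<cdot>\<^sub>v v" if "k < length Ps" for k
    using assms[OF that] that by auto
  ultimately show ?thesis by blast
qed

section \<open>Abelian subgroups\<close>

text \<open>\<open>A\<close> generates itself, so there is a generating subset of least cardinality.
  It is independent, since a member generated by the others could be dropped.\<close>

lemma exists_independent_generators: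
  assumes A: "subgroup A (pauli_group n)" "finite A"
  shows "\<exists>Ps. independent_generators n A Ps"
proof -
  interpret group "pauli_group n" by (rule group_pauli_group)
  let ?gen = "generate (pauli_group n)"
  have "?gen A = A"
    using generateI[OF A(1) order_refl] by blast
  then have "\<exists>X. (X \<subseteq> A \<and> ?gen X = A) \<and> (\<forall>Y. Y \<subseteq> A \<and> ?gen Y = A \<longrightarrow> card X \<le> card Y)"
    by (intro ex_has_least_nat[of _ A]) simp
  then obtain X where X: "X \<subseteq> A" "?gen X = A"
    and min: "\<And>Y. Y \<subseteq> A \<Longrightarrow> ?gen Y = A \<Longrightarrow> card X \<le> card Y"
    by auto
  have fin: "finite X" using X(1) A(2) finite_subset by blast
  have sub: "X \<subseteq> carrier (pauli_group n)" using X(1) subgroup.subset[OF A(1)] by blast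
  have "P \<notin> ?gen (X - {P})" if P: "P \<in> X" for P
  proof
    assume "P \<in> ?gen (X - {P})"
    then have "X \<subseteq> ?gen (X - {P})" by (auto intro: generate.incl)
    moreover have "subgroup (?gen (X - {P})) (pauli_group n)"
      using sub by (intro generate_is_subgroup) auto
    ultimately have "?gen X \<subseteq> ?gen (X - {P})" by (rule generate_subgroup_incl)
    moreover have "?gen (X - {P}) \<subseteq> ?gen X" by (intro mono_generate) auto
    ultimately have "card X \<le> card (X - {P})" using X by (intro min) auto
    moreover have "card (X - {P}) < card X" using fin P by (intro psubset_card_mono) auto
    ultimately show False by simp
  qed
  moreover obtain Ps where "set Ps = X" "distinct Ps" using finite_distinct_list[OF fin] by blast
  ultimately show ?thesis using X by (auto simp: independent_generators_def)
qed

lemma smult_smult_times: "c \<cdot>\<^sub>m (k \<cdot>\<^sub>m A) = (c * k :: 'a :: semigroup_mult) \<cdot>\<^sub>m A"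
  by (intro eq_matI) (auto simp: mult.assoc)

lemma uminus_mat_smult: "- P = (- 1) \<cdot>\<^sub>m (P :: 'a :: ring_1 mat)"
  by (intro eq_matI) auto

lemma abelian_subgroup_signed:
  assumes "abelian_subgroup n A" "U \<in> A"
  shows "\<exists>s \<in> {1, - 1}. \<exists>P \<in> pauli_ops n. U = s \<cdot>\<^sub>m P"
proof -
  have "U \<in> pauli_ops n \<or> (\<exists>P \<in> pauli_ops n. U = - P)"
    using assms by (auto simp: abelian_subgroup_def)
  moreover have "U = 1 \<cdot>\<^sub>m U" by (intro eq_matI) auto
  ultimately show ?thesis unfolding uminus_mat_smult by blast
qed

lemma abelian_subgroup_carrier:
  "abelian_subgroup n A \<Longrightarrow> A \<subseteq> carrier_mat (2 ^ n) (2 ^ n)"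
  using abelian_subgroup_signed pauli_ops_carrier by fastforce

lemma abelian_subgroup_square:
  assumes "abelian_subgroup n A" "U \<in> A"
  shows "U * U = 1\<^sub>m (2 ^ n)"
proof -
  obtain s P where "s \<in> {1, - 1}" and P: "P \<in> pauli_ops n" and "U = s \<cdot>\<^sub>m P"
    using abelian_subgroup_signed[OF assms] by blast
  then show ?thesis
    using pauli_group_mult[OF P P] pauli_ops_square[OF P] by (auto intro!: eq_matI)
qed

lemma abelian_subgroup_commute:
  "abelian_subgroup n A \<Longrightarrow> U \<in> A \<Longrightarrow> V \<in> A \<Longrightarrow> U * V = V * U"
  by (auto simp: abelian_subgroup_def)

lemma abelian_subgroup_mult:
  "abelian_subgroup n A \<Longrightarrow> U \<in> A \<Longrightarrow> V \<in> A \<Longrightarrow> U * V \<in> A"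
  using subgroup.m_closed[of A "pauli_group n" U V] by (auto simp: abelian_subgroup_def pauli_group_def)

lemma one_in_abelian_subgroup: "abelian_subgroup n A \<Longrightarrow> 1\<^sub>m (2 ^ n) \<in> A"
  using subgroup.one_closed[of A "pauli_group n"] by (auto simp: abelian_subgroup_def pauli_group_def)

lemma finite_abelian_subgroup: "abelian_subgroup n A \<Longrightarrow> finite A"
  using finite_pauli_ops[of n] unfolding abelian_subgroup_def by (metis finite_UnI finite_imageI finite_subset)

lemma abelian_subgroup_commute_pauli:
  assumes "abelian_subgroup n A" "U \<in> A" "Q \<in> pauli_ops n"
  shows "\<exists>s \<in> {1, - 1}. U * Q = s \<cdot>\<^sub>m (Q * U)"
proof -
  obtain r P where r: "r \<in> {1, - 1}" and P: "P \<in> pauli_ops n" and U: "U = r \<cdot>\<^sub>m P"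
    using abelian_subgroup_signed[OF assms(1,2)] by blast
  obtain s where s: "s \<in> {1, - 1}" "P * Q = s \<cdot>\<^sub>m (Q * P)"
    using pauli_ops_commute[OF P assms(3)] by blast
  have "U * Q = s \<cdot>\<^sub>m (Q * U)"
    unfolding U using pauli_ops_carrier[OF P] pauli_ops_carrier[OF assms(3)] s(2)
    by (simp add: mult_smult_distrib[of _ "2 ^ n" "2 ^ n" _ "2 ^ n"]
        mult_smult_assoc_mat[of _ "2 ^ n" "2 ^ n" _ "2 ^ n"] smult_smult_times mult.commute)
  with s(1) show ?thesis by blast
qed

lemma unsigned_signed: "P \<in> unsigned n A \<Longrightarrow> \<exists>s \<in> {1, - 1}. s \<cdot>\<^sub>m P \<in> A"
proof -
  assume "P \<in> unsigned n A"
  moreover have "1 \<cdot>\<^sub>m P = P" by (intro eq_matI) auto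
  ultimately show ?thesis unfolding unsigned_def uminus_mat_smult by fastforce
qed

lemma smult_sign_cancel:
  fixes M N :: "complex mat"
  assumes "r \<in> {1, - 1}" "r \<cdot>\<^sub>m M = r \<cdot>\<^sub>m N"
  shows "M = N"
proof -
  have "r \<cdot>\<^sub>m (r \<cdot>\<^sub>m M) = r \<cdot>\<^sub>m (r \<cdot>\<^sub>m N)" using assms(2) by simp
  moreover have "r \<cdot>\<^sub>m (r \<cdot>\<^sub>m K) = K" for K using assms(1) by (intro eq_matI) auto
  ultimately show ?thesis by simp
qed

lemma unsigned_commute:
  assumes A: "abelian_subgroup n A" and U: "U \<in> A" and Q: "Q \<in> unsigned n A"
  shows "U * Q = Q * U"
proof -
  obtain r where r: "r \<in> {1, - 1}" "r \<cdot>\<^sub>m Q \<in> A" using unsigned_signed[OF Q] by blast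
  have c: "U \<in> carrier_mat (2 ^ n) (2 ^ n)" "Q \<in> carrier_mat (2 ^ n) (2 ^ n)"
    using abelian_subgroup_carrier[OF A] U Q pauli_ops_carrier by (auto simp: unsigned_def)
  have "r \<cdot>\<^sub>m (U * Q) = r \<cdot>\<^sub>m (Q * U)"
    using abelian_subgroup_commute[OF A U r(2)] c
    by (simp add: mult_smult_distrib[of _ "2 ^ n" "2 ^ n" _ "2 ^ n"]
        mult_smult_assoc_mat[of _ "2 ^ n" "2 ^ n" _ "2 ^ n"])
  with r(1) show ?thesis by (rule smult_sign_cancel)
qed

text \<open>Agreement of eigenvalues at \<open>y\<close> and \<open>u\<close> passes from generators
  to the whole generated subgroup: eigenvalues multiply along products, and each element of
  \<open>A\<close> is its own inverse. This carries information from a list of independent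
  generators to an arbitrary element.\<close>

lemma generate_joint_eigenvalue:
  assumes A: "abelian_subgroup n A" and G: "G \<subseteq> A" and U: "U \<in> generate (pauli_group n) G"
    and y: "y \<in> carrier_vec (2 ^ n)" and u: "u \<in> carrier_vec (2 ^ n)"
    and ev: "\<And>P. P \<in> G \<Longrightarrow> \<exists>s. P *\<^sub>v y = s \<cdot>\<^sub>v y \<and> P *\<^sub>v u = s \<cdot>\<^sub>v u"
  shows "\<exists>s. U *\<^sub>v y = s \<cdot>\<^sub>v y \<and> U *\<^sub>v u = s \<cdot>\<^sub>v u"
  using U
proof (induction rule: generate.induct)
  case one
  show ?case using y u by (intro exI[of _ 1]) (simp add: pauli_group_def)
next
  case (incl h)
  then show ?case by (rule ev)
next
  case (inv h)
  interpret group "pauli_group n" by (rule group_pauli_group)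
  have "h \<in> A" using inv G by blast
  moreover have "h \<in> carrier (pauli_group n)"
    using \<open>h \<in> A\<close> A subgroup.subset unfolding abelian_subgroup_def by blast
  ultimately have "inv\<^bsub>pauli_group n\<^esub> h = h"
    using abelian_subgroup_square[OF A] by (intro inv_equality) (auto simp: pauli_group_def)
  then show ?case using ev[OF inv] by simp
next
  case (eng h1 h2)
  have "generate (pauli_group n) G \<subseteq> A"
    using A G by (intro group.generate_subgroup_incl[OF group_pauli_group]) (auto simp: abelian_subgroup_def)
  then have c: "h1 \<in> carrier_mat (2 ^ n) (2 ^ n)" "h2 \<in> carrier_mat (2 ^ n) (2 ^ n)"
    using eng.hyps abelian_subgroup_carrier[OF A] by auto
  obtain s t where "h1 *\<^sub>v y = s \<cdot>\<^sub>v y" "h1 *\<^sub>v u = s \<cdot>\<^sub>v u" "h2 *\<^sub>v y = t \<cdot>\<^sub>v y" "h2 *\<^sub>v u = t \<cdot>\<^sub>v u"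
    using eng.IH by blast
  then show ?case
    using c y u
    by (intro exI[of _ "t * s"]) (simp add: pauli_group_def mult_mat_vec smult_smult_assoc
        assoc_mult_mat_vec[of _ "2 ^ n" "2 ^ n" _ "2 ^ n"])
qed

section \<open>Complementary subgroups\<close>

lemma exists_normalized:
  fixes w :: "complex vec"
  assumes "w \<in> carrier_vec d" "w \<noteq> 0\<^sub>v d"
  shows "\<exists>c. (c \<cdot>\<^sub>v w) \<bullet>c (c \<cdot>\<^sub>v w) = 1"
proof -
  have nn: "w \<bullet>c w = complex_of_real (\<Sum>i<d. (cmod (w $ i))\<^sup>2)"
    using assms(1) by (simp only: of_real_sum complex_norm_square) (simp add: scalar_prod_def lessThan_atLeast0)
  let ?N = "\<Sum>i<d. (cmod (w $ i))\<^sup>2"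
  have "?N \<noteq> 0"
  proof
    assume "?N = 0"
    then have "w \<bullet>c w = 0" unfolding nn by (simp only: of_real_0)
    then show False using assms conjugate_square_eq_0_vec[OF assms(1)] by simp
  qed
  then have "?N > 0" using sum_nonneg[of "{..<d}" "\<lambda>i. (cmod (w $ i))\<^sup>2"] by auto
  let ?c = "complex_of_real (1 / sqrt ?N)"
  have "(c \<cdot>\<^sub>v w) \<bullet>c (c \<cdot>\<^sub>v w) = c * cnj c * (w \<bullet>c w)" for c
    using assms(1) by (simp add: scalar_prod_def sum_distrib_left mult_ac)
  then have "(?c \<cdot>\<^sub>v w) \<bullet>c (?c \<cdot>\<^sub>v w) = ?c * ?c * (w \<bullet>c w)"
    by (simp only: complex_cnj_complex_of_real)
  also have "\<dots> = complex_of_real (1 / sqrt ?N * (1 / sqrt ?N) * ?N)"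
    by (simp only: nn of_real_mult)
  also have "1 / sqrt ?N * (1 / sqrt ?N) * ?N = 1"
    using \<open>?N > 0\<close> by (simp add: field_simps)
  finally show ?thesis by (metis of_real_1)
qed

text \<open>If \<open>- s\<close> were the only eigenvalue, all diagonal entries would be
  \<open>- s\<close>, contradicting the vanishing trace of a nontrivial Pauli operator. So some
  \<open>w\<close> lies outside the eigenspace of \<open>- s\<close> and has a nonzero component in
  that of \<open>s\<close>.\<close>

lemma pauli_ops_eigenvalue_attained:
  assumes Q: "Q \<in> pauli_ops n" "Q \<noteq> 1\<^sub>m (2 ^ n)" and s: "s \<in> {1, - 1}"
  shows "\<exists>u \<in> carrier_vec (2 ^ n). u \<noteq> 0\<^sub>v (2 ^ n) \<and> Q *\<^sub>v u = s \<cdot>\<^sub>v u"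
proof -
  let ?d = "2 ^ n :: nat"
  have c: "Q \<in> carrier_mat ?d ?d" using Q pauli_ops_carrier by blast
  have "\<exists>w \<in> carrier_vec ?d. Q *\<^sub>v w \<noteq> (- s) \<cdot>\<^sub>v w"
  proof (rule ccontr)
    assume H: "\<not> ?thesis"
    have entry: "Q $$ (i, i) = - s" if "i < ?d" for i
    proof -
      have "Q *\<^sub>v unit_vec ?d i = (- s) \<cdot>\<^sub>v unit_vec ?d i"
        using H unit_vec_carrier by blast
      then have "(Q *\<^sub>v unit_vec ?d i) $ i = ((- s) \<cdot>\<^sub>v unit_vec ?d i) $ i" by simp
      then show ?thesis using that c by simp
    qed
    have "mat_trace Q = 0"
      using pauli_ops_trace[OF Q(1) one_in_pauli_ops] Q(2) c by simp
    moreover have "mat_trace Q = - (of_nat ?d * s)"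
      using c by (simp add: mat_trace_def entry)
    ultimately show False using s by auto
  qed
  then obtain w where w: "w \<in> carrier_vec ?d" "Q *\<^sub>v w \<noteq> (- s) \<cdot>\<^sub>v w" by blast
  have Qw: "Q *\<^sub>v w \<in> carrier_vec ?d" using c w by simp
  \<comment> \<open>Up to the scalar \<open>2 * s\<close> this is the projection
    \<open>(1 + s Q) / 2\<close> applied to \<open>w\<close>.\<close>
  let ?u = "s \<cdot>\<^sub>v w + Q *\<^sub>v w"
  have "Q *\<^sub>v (Q *\<^sub>v w) = w"
    using c w pauli_ops_square[OF Q(1)] by (simp flip: assoc_mult_mat_vec)
  then have "Q *\<^sub>v ?u = s \<cdot>\<^sub>v (Q *\<^sub>v w) + w"
    using c w Qw by (simp add: mult_add_distrib_mat_vec[of _ ?d ?d] mult_mat_vec)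
  also have "\<dots> = s \<cdot>\<^sub>v ?u"
    using s w Qw c by (intro eq_vecI) (auto simp del: index_mult_mat_vec)
  finally have "Q *\<^sub>v ?u = s \<cdot>\<^sub>v ?u" .
  moreover have "?u \<noteq> 0\<^sub>v ?d"
  proof
    assume *: "?u = 0\<^sub>v ?d"
    have "Q *\<^sub>v w = (- s) \<cdot>\<^sub>v w"
    proof (rule eq_vecI)
      fix i assume "i < dim_vec ((- s) \<cdot>\<^sub>v w)"
      then have i: "i < ?d" using w by simp
      then have "?u $ i = 0" using * by simp
      then show "(Q *\<^sub>v w) $ i = ((- s) \<cdot>\<^sub>v w) $ i"
        using i w Qw c by (simp add: add_eq_0_iff del: index_mult_mat_vec)
    qed (use c w in auto)
    with w(2) show False by simp
  qed
  moreover have "?u \<in> carrier_vec ?d" using w Qw by simp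
  ultimately show ?thesis by blast
qed

text \<open>The signs of \<open>v\<close> on a list of independent generators spell out the outcome
  that is certain.\<close>

lemma maximal_information_ket_bra:
  assumes A: "abelian_subgroup n A" and v: "pure_state n v"
    and ev: "\<And>U. U \<in> A \<Longrightarrow> \<exists>s \<in> {1, - 1}. U *\<^sub>v v = s \<cdot>\<^sub>v v"
  shows "maximal_information n A (ket_bra v)"
proof -
  have v': "v \<in> carrier_vec (2 ^ n)" "v \<bullet>c v = 1" using v by (auto simp: pure_state_def)
  obtain Ps where Ps: "independent_generators n A Ps"
    using exists_independent_generators[of A n] A finite_abelian_subgroup[OF A]
    by (auto simp: abelian_subgroup_def)
  then have sub: "set Ps \<subseteq> A" by (auto simp: independent_generators_def)
  then have c: "set Ps \<subseteq> carrier_mat (2 ^ n) (2 ^ n)" using abelian_subgroup_carrier[OF A] by blast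
  have "\<exists>x \<in> carrier (Z2_pow (length Ps)). \<forall>k < length Ps. Ps ! k *\<^sub>v v = ((- 1) powi x k) \<cdot>\<^sub>v v"
    using sub by (intro exists_outcome_label ev) auto
  then obtain x0 where x0: "x0 \<in> carrier (Z2_pow (length Ps))"
    "\<And>k. k < length Ps \<Longrightarrow> Ps ! k *\<^sub>v v = ((- 1) powi x0 k) \<cdot>\<^sub>v v" by blast
  have "outcome_prob n Ps (ket_bra v) x = (if x = x0 then 1 else 0)"
    if "x \<in> carrier (Z2_pow (length Ps))" for x
    using v' by (simp add: outcome_prob_ket_bra[OF c] joint_projector_eigenvector[OF c v'(1) that x0])
  with Ps x0(1) show ?thesis unfolding maximal_information_def by blast
qed

text \<open>Suppose \<open>Q v = s v\<close>. An outcome \<open>x\<close> of \<open>B\<close> at which \<open>Q\<close> takes the value \<open>- s\<close> exists because \<open>Q\<close> is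
  traceless, and it cannot occur in the state \<open>v\<close>.\<close>

lemma unbiased_not_eigenvector:
  assumes B: "abelian_subgroup n B" and v: "v \<in> carrier_vec (2 ^ n)"
    and unb: "unbiased n B (ket_bra v)"
    and Q: "Q \<in> unsigned_nontrivial n B" and s: "s \<in> {1, - 1}"
  shows "Q *\<^sub>v v \<noteq> s \<cdot>\<^sub>v v"
proof
  assume Qv: "Q *\<^sub>v v = s \<cdot>\<^sub>v v"
  let ?d = "2 ^ n :: nat"
  have Q': "Q \<in> pauli_ops n" "Q \<noteq> 1\<^sub>m ?d" and "Q \<in> unsigned n B"
    using Q by (auto simp: unsigned_nontrivial_def unsigned_def)
  note QB = unsigned_commute[OF B _ this(3)]
  obtain r where r: "r \<in> {1, - 1}" "r \<cdot>\<^sub>m Q \<in> B"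
    using unsigned_signed[OF \<open>Q \<in> unsigned n B\<close>] by blast
  have Qc: "Q \<in> carrier_mat ?d ?d" using pauli_ops_carrier[OF Q'(1)] .
  have Bc: "B \<subseteq> carrier_mat ?d ?d" by (rule abelian_subgroup_carrier[OF B])
  \<comment> \<open>First an eigenvector \<open>u0\<close> of \<open>Q\<close> for
    \<open>- s\<close>; since \<open>Q\<close> commutes with \<open>B\<close>,
    \<open>joint_eigenvector\<close> replaces it by a joint eigenvector \<open>u\<close> of
    \<open>B\<close> with the same eigenvalue of \<open>Q\<close>. The label of \<open>u\<close> is
    the outcome \<open>x\<close> sought.\<close>
  have "- s \<in> {1, - 1}" using s by auto
  from pauli_ops_eigenvalue_attained[OF Q' this] obtain u0
    where u0: "u0 \<in> carrier_vec ?d" "u0 \<noteq> 0\<^sub>v ?d" "Q *\<^sub>v u0 = (- s) \<cdot>\<^sub>v u0" by blast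
  from joint_eigenvector[OF finite_abelian_subgroup[OF B] Bc abelian_subgroup_square[OF B]
      abelian_subgroup_commute[OF B] u0(1,2)]
  obtain u where u: "u \<in> carrier_vec ?d" "u \<noteq> 0\<^sub>v ?d"
    and ev: "\<And>U. U \<in> B \<Longrightarrow> \<exists>s \<in> {1, - 1}. U *\<^sub>v u = s \<cdot>\<^sub>v u"
    and Qu: "Q *\<^sub>v u = (- s) \<cdot>\<^sub>v u"
    using Qc QB u0(3) by blast
  obtain Ps where Ps: "independent_generators n B Ps"
    and prob: "\<And>x. x \<in> carrier (Z2_pow (length Ps)) \<Longrightarrow> outcome_prob n Ps (ket_bra v) x = 1 / 2 ^ length Ps"
    using unb unfolding unbiased_def by blast
  have sub: "set Ps \<subseteq> B" and gen: "generate (pauli_group n) (set Ps) = B"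
    using Ps by (auto simp: independent_generators_def)
  have c: "set Ps \<subseteq> carrier_mat ?d ?d" using sub Bc by blast
  have "\<exists>x \<in> carrier (Z2_pow (length Ps)). \<forall>k < length Ps. Ps ! k *\<^sub>v u = ((- 1) powi x k) \<cdot>\<^sub>v u"
    using sub by (intro exists_outcome_label ev) auto
  then obtain x where x: "x \<in> carrier (Z2_pow (length Ps))"
    "\<And>k. k < length Ps \<Longrightarrow> Ps ! k *\<^sub>v u = ((- 1) powi x k) \<cdot>\<^sub>v u" by blast
  let ?\<Pi> = "joint_projector n Ps x"
  have \<Pi>: "?\<Pi> \<in> carrier_mat ?d ?d" by (rule joint_projector_carrier[OF c])
  \<comment> \<open>\<open>y\<close> is the component of \<open>v\<close> with outcome
    \<open>x\<close>. It is nonzero, because unbiasedness gives this outcome the positive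
    probability \<open>1 / 2 ^ length Ps\<close>.\<close>
  define y where "y = ?\<Pi> *\<^sub>v v"
  have y: "y \<in> carrier_vec ?d" using \<Pi> v by (simp add: y_def)
  have "y \<bullet>c v \<noteq> 0"
    using prob[OF x(1)] by (simp add: outcome_prob_ket_bra[OF c v] y_def)
  have absorb: "Ps ! k * ?\<Pi> = ((- 1) powi x k) \<cdot>\<^sub>m ?\<Pi>" if "k < length Ps" for k
    using sub abelian_subgroup_commute[OF B] abelian_subgroup_square[OF B]
    by (intro joint_projector_absorb[OF c _ _ x(1) that]) blast+
  have "Ps ! k *\<^sub>v y = ((- 1) powi x k) \<cdot>\<^sub>v y" if k: "k < length Ps" for k
  proof -
    have "Ps ! k \<in> carrier_mat ?d ?d" using c k by auto
    then have "Ps ! k *\<^sub>v y = (Ps ! k * ?\<Pi>) *\<^sub>v v"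
      using \<Pi> v by (simp add: y_def assoc_mult_mat_vec[of _ ?d ?d _ ?d])
    then show ?thesis
      using \<Pi> v absorb[OF k] by (simp add: y_def smult_mult_mat_vec[of _ ?d ?d])
  qed
  \<comment> \<open>\<open>y\<close> and \<open>u\<close> have the same label on the generators, so
    the element \<open>r \<cdot>\<^sub>m Q\<close> of \<open>B\<close> has one common eigenvalue
    \<open>t\<close> on both.\<close>
  with x(2) have "\<exists>t. P *\<^sub>v y = t \<cdot>\<^sub>v y \<and> P *\<^sub>v u = t \<cdot>\<^sub>v u" if "P \<in> set Ps" for P
    using that by (metis in_set_conv_nth)
  from generate_joint_eigenvalue[OF B sub _ y u(1) this, of "r \<cdot>\<^sub>m Q"] r(2) gen
  obtain t where t: "(r \<cdot>\<^sub>m Q) *\<^sub>v y = t \<cdot>\<^sub>v y" "(r \<cdot>\<^sub>m Q) *\<^sub>v u = t \<cdot>\<^sub>v u" by blast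
  \<comment> \<open>The projector commutes with \<open>Q\<close>, so \<open>y\<close> inherits the
    eigenvalue \<open>s\<close> from \<open>v\<close>. With \<open>- s\<close> at \<open>u\<close>,
    this forces \<open>t\<close> to be both \<open>r * s\<close> and
    \<open>- (r * s)\<close>.\<close>
  have "Q *\<^sub>v y = (Q * ?\<Pi>) *\<^sub>v v"
    using Qc \<Pi> v by (simp add: y_def assoc_mult_mat_vec[of _ ?d ?d _ ?d])
  also have "Q * ?\<Pi> = ?\<Pi> * Q"
    using sub QB by (intro joint_projector_commute[OF c Qc]) (auto simp: subset_iff)
  also have "(?\<Pi> * Q) *\<^sub>v v = s \<cdot>\<^sub>v y"
    using Qc \<Pi> v Qv by (simp add: y_def assoc_mult_mat_vec[of _ ?d ?d _ ?d] mult_mat_vec)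
  finally have "(r * s) \<cdot>\<^sub>v y = t \<cdot>\<^sub>v y"
    using t(1) Qc y by (simp add: smult_mult_mat_vec[of _ ?d ?d] smult_smult_assoc)
  moreover have "(r * - s) \<cdot>\<^sub>v u = t \<cdot>\<^sub>v u"
    using t(2) Qc u(1) Qu by (simp add: smult_mult_mat_vec[of _ ?d ?d] smult_smult_assoc)
  ultimately have eq: "y $ i = 0 \<or> r * s = t" "u $ i = 0 \<or> r * - s = t" if "i < ?d" for i
    using that y u(1) by (metis carrier_vecD index_smult_vec(1) mult_right_cancel)+
  have "\<exists>i < ?d. y $ i \<noteq> 0"
    using y v \<open>y \<bullet>c v \<noteq> 0\<close> by (metis carrier_vecD eq_vecI index_zero_vec carrier_vec_conjugate scalar_prod_left_zero)
  moreover have "\<exists>i < ?d. u $ i \<noteq> 0"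
    using u by (metis carrier_vecD eq_vecI index_zero_vec)
  ultimately have "r * s = t" "r * - s = t" using eq by blast+
  then show False using r(1) s by auto
qed

lemma complementary_anticommute:
  assumes A: "abelian_subgroup n A" and B: "abelian_subgroup n B" and "complementary n A B"
    and Q: "Q \<in> unsigned_nontrivial n B"
  shows "\<exists>U \<in> A. U * Q = (- 1) \<cdot>\<^sub>m (Q * U)"
proof (rule ccontr)
  assume H: "\<not> ?thesis"
  let ?d = "2 ^ n :: nat"
  have Q': "Q \<in> pauli_ops n" using Q by (auto simp: unsigned_nontrivial_def unsigned_def)
  \<comment> \<open>Pauli operators either commute or anticommute, so without an anticommuting
    element \<open>Q\<close> commutes with all of \<open>A\<close>, and \<open>insert Q A\<close> is
    a commuting family of involutions.\<close>
  have QA: "U * Q = Q * U" if "U \<in> A" for U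
  proof -
    have "U * Q = 1 \<cdot>\<^sub>m (Q * U)" using abelian_subgroup_commute_pauli[OF A that Q'] H that by blast
    then show ?thesis by (auto intro!: eq_matI)
  qed
  have fin: "finite (insert Q A)" using finite_abelian_subgroup[OF A] by simp
  have sub: "insert Q A \<subseteq> carrier_mat ?d ?d"
    using abelian_subgroup_carrier[OF A] pauli_ops_carrier[OF Q'] by simp
  have sq: "U * U = 1\<^sub>m ?d" if "U \<in> insert Q A" for U
    using that abelian_subgroup_square[OF A] pauli_ops_square[OF Q'] by auto
  have comm: "U * V = V * U" if "U \<in> insert Q A" "V \<in> insert Q A" for U V
    using that abelian_subgroup_commute[OF A] QA by auto
  have "unit_vec ?d 0 \<noteq> (0\<^sub>v ?d :: complex vec)"
  proof
    assume "unit_vec ?d 0 = (0\<^sub>v ?d :: complex vec)"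
    then have "unit_vec ?d 0 $ 0 = (0\<^sub>v ?d :: complex vec) $ 0" by simp
    then show False by simp
  qed
  from joint_eigenvector[OF fin sub sq comm unit_vec_carrier this]
  obtain w where w: "w \<in> carrier_vec ?d" "w \<noteq> 0\<^sub>v ?d"
    and ev: "\<And>U. U \<in> insert Q A \<Longrightarrow> \<exists>s \<in> {1, - 1}. U *\<^sub>v w = s \<cdot>\<^sub>v w" by blast
  obtain a where a: "(a \<cdot>\<^sub>v w) \<bullet>c (a \<cdot>\<^sub>v w) = 1" using exists_normalized[OF w] by blast
  define v where "v = a \<cdot>\<^sub>v w"
  have v: "pure_state n v" "v \<in> carrier_vec ?d" using a w by (auto simp: v_def pure_state_def)
  have ev': "\<exists>s \<in> {1, - 1}. U *\<^sub>v v = s \<cdot>\<^sub>v v" if U: "U \<in> insert Q A" for U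
  proof -
    obtain s where s: "s \<in> {1, - 1}" "U *\<^sub>v w = s \<cdot>\<^sub>v w" using ev[OF U] by blast
    moreover have "U \<in> carrier_mat ?d ?d" using sub U by blast
    ultimately have "U *\<^sub>v v = s \<cdot>\<^sub>v v"
      using w by (simp add: v_def mult_mat_vec smult_smult_assoc mult.commute)
    with s(1) show ?thesis by blast
  qed
  have "maximal_information n A (ket_bra v)"
    using ev' by (intro maximal_information_ket_bra[OF A v(1)]) auto
  then have "unbiased n B (ket_bra v)"
    using assms(3) density_operator_ket_bra[OF v(1)] unfolding complementary_def by blast
  moreover obtain s where "s \<in> {1, - 1}" "Q *\<^sub>v v = s \<cdot>\<^sub>v v" using ev'[OF insertI1] by blast
  ultimately show False using unbiased_not_eigenvector[OF B v(2) _ Q] by metis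
qed

section \<open>Trace sums over a subgroup and over its unsigned form\<close>

lemma mat_trace_smult:
  fixes M :: "'a :: semiring_0 mat"
  assumes "M \<in> carrier_mat d d"
  shows "mat_trace (c \<cdot>\<^sub>m M) = c * mat_trace M"
  using assms by (simp add: mat_trace_def sum_distrib_left)

text \<open>Translation by \<open>U0\<close> permutes \<open>A\<close> and reverses the sign of every summand.\<close>

lemma sum_square_anticommuting:
  assumes A: "abelian_subgroup n A" and Q: "Q \<in> carrier_mat (2 ^ n) (2 ^ n)"
    and U0: "U0 \<in> A" and anti: "U0 * Q = (- 1) \<cdot>\<^sub>m (Q * U0)"
  shows "(\<Sum>U\<in>A. mat_trace (U * Q * (U * Q))) = 0"
proof -
  let ?d = "2 ^ n :: nat" and ?f = "\<lambda>U. mat_trace (U * Q * (U * Q))"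
  note Ac = abelian_subgroup_carrier[OF A]
  have U0c: "U0 \<in> carrier_mat ?d ?d" using Ac U0 by blast
  have sq: "U0 * U0 = 1\<^sub>m ?d" by (rule abelian_subgroup_square[OF A U0])
  have cancel: "U0 * (U0 * U) = U" if "U \<in> carrier_mat ?d ?d" for U
    using assoc_mult_mat[OF U0c U0c that] that by (simp add: sq)
  \<comment> \<open>Since \<open>U0 * U0 = 1\<close>, the translation is its own inverse.\<close>
  have "bij_betw ((*) U0) A A"
    using cancel Ac abelian_subgroup_mult[OF A U0]
    by (intro bij_betw_byWitness[where f' = "(*) U0"]) auto
  then have "(\<Sum>U\<in>A. ?f U) = (\<Sum>U\<in>A. ?f (U0 * U))"
    by (rule sum.reindex_bij_betw[symmetric])
  also have "\<dots> = (\<Sum>U\<in>A. - ?f U)"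
  proof (rule sum.cong[OF refl])
    fix U assume U: "U \<in> A"
    then have Uc: "U \<in> carrier_mat ?d ?d" using Ac by blast
    let ?V = "U * Q"
    have V: "?V \<in> carrier_mat ?d ?d" using Uc Q by simp
    have "Q * U0 = (- 1) \<cdot>\<^sub>m (U0 * Q)"
      unfolding anti using Q U0c by (intro eq_matI) auto
    then have "?V * U0 = (- 1) \<cdot>\<^sub>m (U * (U0 * Q))"
      using Uc Q U0c by (simp add: mult_smult_distrib[of _ ?d ?d _ ?d] assoc_mult_mat[of _ ?d ?d _ ?d _ ?d])
    also have "U * (U0 * Q) = U0 * ?V"
      using abelian_subgroup_commute[OF A U U0] Uc Q U0c by (simp flip: assoc_mult_mat)
    finally have VU: "?V * U0 = (- 1) \<cdot>\<^sub>m (U0 * ?V)" .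
    \<comment> \<open>Moving the second \<open>U0\<close> leftwards past \<open>U * Q\<close> costs
      one sign, after which the two copies of \<open>U0\<close> cancel.\<close>
    have "(U0 * U) * Q * ((U0 * U) * Q) = U0 * ((?V * U0) * ?V)"
      using Uc Q U0c V by (simp add: assoc_mult_mat[of _ ?d ?d _ ?d _ ?d])
    also have "\<dots> = (- 1) \<cdot>\<^sub>m (U0 * (U0 * (?V * ?V)))"
      using U0c V
      by (simp add: VU mult_smult_distrib[of _ ?d ?d _ ?d] mult_smult_assoc_mat[of _ ?d ?d _ ?d]
          assoc_mult_mat[of U0 ?d ?d ?V ?d ?V ?d])
    also have "\<dots> = (- 1) \<cdot>\<^sub>m (?V * ?V)" using V by (simp add: cancel)
    finally show "?f (U0 * U) = - ?f U"
      using V by (simp add: mat_trace_smult[of _ ?d])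
  qed
  finally show ?thesis by (simp add: sum_negf)
qed

text \<open>Otherwise \<open>P * - P\<close> would have trace 0 or \<open>2 ^ n\<close> by
  orthogonality, while it is minus the identity.\<close>

lemma uminus_notin_pauli_ops:
  assumes "P \<in> pauli_ops n"
  shows "- P \<notin> pauli_ops n"
proof
  assume "- P \<in> pauli_ops n"
  then have "mat_trace (P * - P) \<in> {0, 2 ^ n}"
    using pauli_ops_trace[OF assms] by auto
  moreover have "P * - P = (- 1) \<cdot>\<^sub>m 1\<^sub>m (2 ^ n)"
    using pauli_ops_carrier[OF assms] pauli_ops_square[OF assms]
    by (simp add: uminus_mat_smult mult_smult_distrib[of _ "2 ^ n" "2 ^ n" _ "2 ^ n"])
  moreover have "2 ^ n \<noteq> - (2 ^ n :: complex)"
    using power_not_zero[of "2 :: complex" n] by (simp add: eq_neg_iff_add_eq_0)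
  ultimately show False by (simp add: mat_trace_def)
qed

text \<open>Exactly one of the two signs occurs in \<open>A\<close>: if \<open>U\<close> and
  \<open>- U\<close> were both in \<open>A\<close>, so would be their product, minus the identity.
  Injectivity holds because no two Pauli operators are negatives of each other.\<close>

lemma unsigned_bij_betw:
  assumes A: "abelian_subgroup n A"
  shows "bij_betw (\<lambda>P. if P \<in> A then P else - P) (unsigned n A) A"
proof (intro bij_betw_imageI inj_onI)
  fix P P' assume P: "P \<in> unsigned n A" "P' \<in> unsigned n A"
    and eq: "(if P \<in> A then P else - P) = (if P' \<in> A then P' else - P')"
  have c: "P \<in> pauli_ops n" "P' \<in> pauli_ops n" using P by (auto simp: unsigned_def)
  have "P = P' \<or> P = - P' \<or> P' = - P"
    using eq by (auto split: if_splits)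
  with c show "P = P'" using uminus_notin_pauli_ops by blast
next
  have neg: "U \<in> pauli_ops n \<or> - U \<in> pauli_ops n" if "U \<in> A" for U
    using that A by (auto simp: abelian_subgroup_def)
  have not_both: "- U \<notin> A" if "U \<in> A" for U
  proof
    assume "- U \<in> A"
    then have "U * - U \<in> A" using that abelian_subgroup_mult[OF A] by blast
    moreover have "U \<in> carrier_mat (2 ^ n) (2 ^ n)" using abelian_subgroup_carrier[OF A] that by blast
    then have "U * - U = - 1\<^sub>m (2 ^ n)"
      using abelian_subgroup_square[OF A that]
      by (simp add: uminus_mat_smult mult_smult_distrib[of _ "2 ^ n" "2 ^ n" _ "2 ^ n"])
    ultimately show False using A by (simp add: abelian_subgroup_def)
  qed
  show "(\<lambda>P. if P \<in> A then P else - P) ` unsigned n A = A"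
  proof (intro equalityI subsetI)
    fix U assume U: "U \<in> A"
    show "U \<in> (\<lambda>P. if P \<in> A then P else - P) ` unsigned n A"
    proof (cases "U \<in> pauli_ops n")
      case True
      then show ?thesis using U by (intro image_eqI[of _ _ U]) (auto simp: unsigned_def)
    next
      case False
      then show ?thesis
        using U neg[OF U] not_both[OF U] by (intro image_eqI[of _ _ "- U"]) (auto simp: unsigned_def)
    qed
  qed (auto simp: unsigned_def)
qed

lemma mat_trace_square_uminus:
  fixes P Q :: "complex mat"
  assumes "P \<in> carrier_mat d d" "Q \<in> carrier_mat d d"
  shows "mat_trace (- P * Q * (- P * Q)) = mat_trace (P * Q * (P * Q))"
  using assms
  by (simp add: uminus_mat_smult mult_smult_assoc_mat[of _ d d _ d] mult_smult_distrib[of _ d d _ d]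
      smult_smult_times mat_trace_def)

text \<open>Each summand contains its operator twice, so the sign chosen by
  \<open>unsigned_bij_betw\<close> cancels.\<close>

lemma sum_square_unsigned:
  assumes A: "abelian_subgroup n A" and Q: "Q \<in> carrier_mat (2 ^ n) (2 ^ n)"
  shows "(\<Sum>P\<in>unsigned n A. mat_trace (P * Q * (P * Q))) = (\<Sum>U\<in>A. mat_trace (U * Q * (U * Q)))"
proof -
  have "(\<Sum>U\<in>A. mat_trace (U * Q * (U * Q))) =
      (\<Sum>P\<in>unsigned n A. let U = if P \<in> A then P else - P in mat_trace (U * Q * (U * Q)))"
    using sum.reindex_bij_betw[OF unsigned_bij_betw[OF A], symmetric] by (simp add: Let_def)
  also have "\<dots> = (\<Sum>P\<in>unsigned n A. mat_trace (P * Q * (P * Q)))"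
    using mat_trace_square_uminus[OF pauli_ops_carrier Q]
    by (intro sum.cong refl) (simp add: Let_def unsigned_def)
  finally show ?thesis ..
qed

section \<open>Nontrivial parts: cardinality, trace sums and disjointness\<close>

lemma has_dimension_card:
  assumes "has_dimension n A m"
  shows "card A = 2 ^ m"
proof -
  obtain h where "h \<in> iso ((pauli_group n)\<lparr>carrier := A\<rparr>) (Z2_pow m)"
    using assms unfolding has_dimension_def is_iso_def by blast
  then have "bij_betw h A (carrier (Z2_pow m))" by (simp add: iso_def)
  then have "card A = card ({..<m} \<rightarrow>\<^sub>E {0, 1 :: int})"
    unfolding carrier_Z2_pow by (rule bij_betw_same_card)
  then show ?thesis by (simp add: card_PiE numeral_2_eq_2)
qed

lemma unsigned_nontrivial_subset: "unsigned_nontrivial n A \<subseteq> pauli_ops n - {1\<^sub>m (2 ^ n)}"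
  by (auto simp: unsigned_nontrivial_def unsigned_def)

lemma finite_unsigned: "finite (unsigned n A)"
  using finite_subset[OF _ finite_pauli_ops[of n]] by (auto simp: unsigned_def)

lemma unsigned_insert:
  assumes "abelian_subgroup n A"
  shows "unsigned n A = insert (1\<^sub>m (2 ^ n)) (unsigned_nontrivial n A)"
  using one_in_pauli_ops one_in_abelian_subgroup[OF assms]
  by (auto simp: unsigned_nontrivial_def unsigned_def)

lemma card_unsigned_nontrivial:
  assumes "abelian_subgroup n A" "has_dimension n A m"
  shows "card (unsigned_nontrivial n A) = 2 ^ m - 1"
proof -
  have "card (unsigned n A) = 2 ^ m"
    using bij_betw_same_card[OF unsigned_bij_betw[OF assms(1)]] has_dimension_card[OF assms(2)] by simp
  moreover have "1\<^sub>m (2 ^ n) \<in> unsigned n A" using unsigned_insert[OF assms(1)] by simp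
  ultimately show ?thesis by (simp add: unsigned_nontrivial_def finite_unsigned)
qed

text \<open>The sum over all of \<open>unsigned n A\<close> vanishes by anticommutation; the
  identity accounts for the trace of \<open>Q * Q\<close>, which is \<open>2 ^ n\<close>.\<close>

lemma sum_square_complementary:
  assumes A: "abelian_subgroup n A" and B: "abelian_subgroup n B" and AB: "complementary n A B"
    and Q: "Q \<in> unsigned_nontrivial n B"
  shows "(\<Sum>P\<in>unsigned_nontrivial n A. mat_trace (P * Q * (P * Q))) = - (2 ^ n)"
proof -
  have Q': "Q \<in> pauli_ops n" using Q unsigned_nontrivial_subset by blast
  then have c: "Q \<in> carrier_mat (2 ^ n) (2 ^ n)" by (rule pauli_ops_carrier)
  obtain U0 where "U0 \<in> A" "U0 * Q = (- 1) \<cdot>\<^sub>m (Q * U0)"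
    using complementary_anticommute[OF A B AB Q] by blast
  then have "0 = (\<Sum>P\<in>unsigned n A. mat_trace (P * Q * (P * Q)))"
    using sum_square_anticommuting[OF A c] sum_square_unsigned[OF A c] by simp
  also have "\<dots> = mat_trace (1\<^sub>m (2 ^ n) * Q * (1\<^sub>m (2 ^ n) * Q)) +
      (\<Sum>P\<in>unsigned_nontrivial n A. mat_trace (P * Q * (P * Q)))"
    unfolding unsigned_insert[OF A] using finite_unsigned[of n A]
    by (subst sum.insert) (auto simp: unsigned_nontrivial_def)
  also have "mat_trace (1\<^sub>m (2 ^ n) * Q * (1\<^sub>m (2 ^ n) * Q)) = 2 ^ n"
    using c pauli_ops_trace[OF Q' Q'] by simp
  finally show ?thesis by (metis add_eq_0_iff)
qed

text \<open>Operators of one subgroup commute, so the fourfold product collapses to the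
  identity.\<close>

lemma mat_trace_square_unsigned:
  assumes A: "abelian_subgroup n A" and P: "P \<in> unsigned n A" and Q: "Q \<in> unsigned n A"
  shows "mat_trace (P * Q * (P * Q)) = 2 ^ n"
proof -
  let ?d = "2 ^ n :: nat"
  have PQ: "P \<in> pauli_ops n" "Q \<in> pauli_ops n" using P Q by (auto simp: unsigned_def)
  note c = PQ[THEN pauli_ops_carrier]
  obtain r where r: "r \<in> {1, - 1}" "r \<cdot>\<^sub>m P \<in> A" using unsigned_signed[OF P] by blast
  have "r \<cdot>\<^sub>m (P * Q) = r \<cdot>\<^sub>m (Q * P)"
    using unsigned_commute[OF A r(2) Q] c
    by (simp add: mult_smult_distrib[of _ ?d ?d _ ?d] mult_smult_assoc_mat[of _ ?d ?d _ ?d])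
  with r(1) have "P * Q = Q * P" by (rule smult_sign_cancel)
  then have "P * Q * (P * Q) = Q * P * (P * Q)" by simp
  also have "\<dots> = Q * (P * P * Q)" using c by (simp add: assoc_mult_mat[of _ ?d ?d _ ?d _ ?d])
  finally show ?thesis
    using c by (simp add: pauli_ops_square[OF PQ(1)] pauli_ops_square[OF PQ(2)] mat_trace_def)
qed

text \<open>A common \<open>Q\<close> would commute with every operator from \<open>A\<close>,
  making the trace sum a nonnegative multiple of \<open>2 ^ n\<close>, while complementarity makes
  it \<open>- (2 ^ n)\<close>.\<close>

lemma complementary_disjoint:
  assumes A: "abelian_subgroup n A" and B: "abelian_subgroup n B" and AB: "complementary n A B"
  shows "unsigned_nontrivial n A \<inter> unsigned_nontrivial n B = {}"
proof (rule ccontr)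
  assume "\<not> ?thesis"
  then obtain Q where Q: "Q \<in> unsigned_nontrivial n A" "Q \<in> unsigned_nontrivial n B" by blast
  then have QA: "Q \<in> unsigned n A" by (simp add: unsigned_nontrivial_def)
  have "(\<Sum>P\<in>unsigned_nontrivial n A. mat_trace (P * Q * (P * Q))) =
      complex_of_nat (card (unsigned_nontrivial n A) * 2 ^ n)"
    using mat_trace_square_unsigned[OF A _ QA] by (simp add: unsigned_nontrivial_def)
  then have "complex_of_nat (card (unsigned_nontrivial n A) * 2 ^ n + 2 ^ n) = 0"
    unfolding sum_square_complementary[OF A B AB Q(2)] by simp (metis add.left_inverse)
  then show False by (simp only: of_nat_eq_0_iff) simp
qed

section \<open>Purity invariance\<close>

theorem theorem3:
  fixes n m :: nat and A :: "nat \<Rightarrow> complex mat set"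
  assumes "1 \<le> n" and "1 \<le> m" and "m \<le> n"
    and "\<And>k. k \<in> {1..2 ^ n + 1} \<Longrightarrow> abelian_subgroup n (A k)"
    and "\<And>k. k \<in> {1..2 ^ n + 1} \<Longrightarrow> has_dimension n (A k) m"
    and "complementary_family n {1..2 ^ n + 1} A"
  shows "disjoint_family_on (\<lambda>k. unsigned_nontrivial n (A k)) {1..2 ^ n + 1} \<and>
    purity_invariant n (\<Union>k \<in> {1..2 ^ n + 1}. unsigned_nontrivial n (A k)) \<and>
    (\<forall>\<psi>. pure_state n \<psi> \<longrightarrow>
       information (\<Union>k \<in> {1..2 ^ n + 1}. unsigned_nontrivial n (A k)) (ket_bra \<psi>) = 2 ^ m - 1)"
proof -
  let ?d = "2 ^ n :: nat" and ?I = "{1..2 ^ n + 1 :: nat}"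
  define F where "F k = unsigned_nontrivial n (A k)" for k
  define S where "S = (\<Union>k\<in>?I. F k)"
  define q where "q = (2 ^ m - 1 :: complex)"
  \<comment> \<open>The weight \<open>- q\<close> at the identity encodes the subtraction of
    \<open>q\<close> from the operator \<open>T\<close>, so that the second-moment criterion applies
    to \<open>insert 1 S\<close>.\<close>
  define a where "a P = (if P = 1\<^sub>m ?d then 1 - 2 ^ m else 1 :: real)" for P :: "complex mat"
  have a: "complex_of_real (a P) = (if P = 1\<^sub>m ?d then - q else 1)" for P
    by (simp add: a_def q_def)
  have compl: "complementary n (A k) (A l)" if "k \<in> ?I" "l \<in> ?I" "k \<noteq> l" for k l
    using assms(6) that unfolding complementary_family_def by blast
  have disj: "F k \<inter> F l = {}" if "k \<in> ?I" "l \<in> ?I" "k \<noteq> l" for k l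
    unfolding F_def by (rule complementary_disjoint) (use that assms(4) compl in blast)+
  have F: "F k \<subseteq> pauli_ops n - {1\<^sub>m ?d}" for k
    unfolding F_def by (rule unsigned_nontrivial_subset)
  have fin: "finite (F k)" for k using F[of k] finite_pauli_ops[of n] finite_subset by blast
  have card_F: "complex_of_nat (card (F k)) = q" if "k \<in> ?I" for k
    using card_unsigned_nontrivial[OF assms(4,5)[OF that]] by (simp add: F_def q_def of_nat_diff)
  have S: "S \<subseteq> pauli_ops n" "1\<^sub>m ?d \<notin> S" "finite S"
    using F fin by (auto simp: S_def)
  have sum_S: "(\<Sum>P\<in>S. g P) = (\<Sum>k\<in>?I. \<Sum>P\<in>F k. g P)" for g :: "complex mat \<Rightarrow> complex"
    unfolding S_def using fin disj by (intro sum.UNION_disjoint) auto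
  let ?g = "\<lambda>P Q. (mat_trace (P * Q))\<^sup>2 + mat_trace (P * Q * (P * Q))"
  \<comment> \<open>Every row of the moment matrix of \<open>insert 1 S\<close> with the weight \<open>- q\<close> at the identity sums to zero.\<close>
  have row: "(\<Sum>P\<in>insert (1\<^sub>m ?d) S. a P * ?g P Q) = 0" if Q: "Q \<in> insert (1\<^sub>m ?d) S" for Q
  proof -
    have Qp: "Q \<in> pauli_ops n" using Q S(1) one_in_pauli_ops by blast
    note Qc = pauli_ops_carrier[OF Qp]
    have tr: "mat_trace (P * Q) = (if P = Q then 2 ^ n else 0)" if "P \<in> S" for P
      using pauli_ops_trace[OF _ Qp] that S(1) by blast
    have tr1: "mat_trace (1\<^sub>m ?d * Q) = (if Q = 1\<^sub>m ?d then 2 ^ n else 0)"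
      using pauli_ops_trace[OF one_in_pauli_ops Qp] by auto
    have "(\<Sum>P\<in>S. a P * ?g P Q) = (\<Sum>P\<in>S. ?g P Q)"
      using S(2) by (intro sum.cong refl) (auto simp: a)
    then have "(\<Sum>P\<in>insert (1\<^sub>m ?d) S. a P * ?g P Q) = - q * ?g (1\<^sub>m ?d) Q + (\<Sum>P\<in>S. ?g P Q)"
      using S(2,3) by (simp add: a)
    \<comment> \<open>By orthogonality the squared trace contributes only at
      \<open>P = Q\<close>.\<close>
    also have "(\<Sum>P\<in>S. ?g P Q) = (if Q \<in> S then (2 ^ n)\<^sup>2 else 0) + (\<Sum>P\<in>S. mat_trace (P * Q * (P * Q)))"
      using S(3) by (simp add: sum.distrib tr if_distrib[of "\<lambda>x. x\<^sup>2"] sum.delta cong: if_cong)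
    also have "?g (1\<^sub>m ?d) Q = (if Q = 1\<^sub>m ?d then (2 ^ n)\<^sup>2 else 0) + 2 ^ n"
      using Qc pauli_ops_trace[OF Qp Qp] tr1 by simp
    also have "(\<Sum>P\<in>S. mat_trace (P * Q * (P * Q))) =
        (if Q \<in> S then q * 2 ^ n - (2 ^ n)\<^sup>2 else (2 ^ n + 1) * q * 2 ^ n)"
    proof (cases "Q \<in> S")
      case True
      then obtain l where l: "l \<in> ?I" "Q \<in> F l" by (auto simp: S_def)
      have same: "(\<Sum>P\<in>F l. mat_trace (P * Q * (P * Q))) = q * 2 ^ n"
        using mat_trace_square_unsigned[OF assms(4)[OF l(1)], of _ Q] l card_F[OF l(1)]
        by (simp add: F_def unsigned_nontrivial_def)
      have other: "(\<Sum>P\<in>F k. mat_trace (P * Q * (P * Q))) = - (2 ^ n)" if "k \<in> ?I - {l}" for k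
        using sum_square_complementary[of n "A k" "A l" Q] assms(4) compl that l by (auto simp: F_def)
      have "(\<Sum>P\<in>S. mat_trace (P * Q * (P * Q))) = (\<Sum>P\<in>F l. mat_trace (P * Q * (P * Q))) +
          (\<Sum>k\<in>?I - {l}. \<Sum>P\<in>F k. mat_trace (P * Q * (P * Q)))"
        unfolding sum_S using l(1) by (intro sum.remove) auto
      also have "\<dots> = q * 2 ^ n + (\<Sum>k\<in>?I - {l}. - (2 ^ n))"
        by (intro arg_cong2[where f = "(+)"] sum.cong same other refl)
      \<comment> \<open>The index set without \<open>l\<close> has exactly \<open>2 ^ n\<close>
        elements, each contributing \<open>- (2 ^ n)\<close>. This is where the number of subgroups
        matters: the result cancels the squared trace at \<open>P = Q\<close>.\<close>
      also have "\<dots> = q * 2 ^ n - (2 ^ n)\<^sup>2" using l(1) by (simp add: power2_eq_square)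
      finally show ?thesis using True by simp
    next
      case False
      then have "Q = 1\<^sub>m ?d" using Q by simp
      moreover have "P * 1\<^sub>m ?d * (P * 1\<^sub>m ?d) = 1\<^sub>m ?d" if "P \<in> S" for P
        using that S(1) pauli_ops_carrier[of P n] pauli_ops_square[of P n] by auto
      ultimately have "(\<Sum>P\<in>S. mat_trace (P * Q * (P * Q))) = (\<Sum>P\<in>S. 2 ^ n)"
        by (intro sum.cong refl) (simp add: mat_trace_def)
      \<comment> \<open>\<open>S\<close> consists of \<open>2 ^ n + 1\<close> disjoint pieces with
        \<open>q\<close> elements each.\<close>
      also have "\<dots> = (2 ^ n + 1) * q * 2 ^ n"
        unfolding sum_S by (simp add: card_F)
      finally show ?thesis using False by simp
    qed
    finally have "(\<Sum>P\<in>insert (1\<^sub>m ?d) S. a P * ?g P Q) =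
        - q * ((if Q = 1\<^sub>m ?d then (2 ^ n)\<^sup>2 else 0) + 2 ^ n) + ((if Q \<in> S then (2 ^ n)\<^sup>2 else 0) +
          (if Q \<in> S then q * 2 ^ n - (2 ^ n)\<^sup>2 else (2 ^ n + 1) * q * 2 ^ n))" .
    also have "\<dots> = 0"
    proof (cases "Q \<in> S")
      case True
      then have "Q \<noteq> 1\<^sub>m ?d" using S(2) by auto
      with True show ?thesis by simp
    next
      case False
      then have "Q = 1\<^sub>m ?d" using Q by simp
      with False show ?thesis by (simp add: algebra_simps power2_eq_square)
    qed
    finally show ?thesis .
  qed
  have info: "information S (ket_bra \<psi>) = 2 ^ m - 1" if \<psi>: "pure_state n \<psi>" for \<psi>
  proof -
    have v: "\<psi> \<in> carrier_vec ?d" "\<psi> \<bullet>c \<psi> = 1" using \<psi> by (auto simp: pure_state_def)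
    have ops: "insert (1\<^sub>m ?d) S \<subseteq> pauli_ops n" using S(1) one_in_pauli_ops by blast
    \<comment> \<open>The second moment is a weighted sum of the row sums, all of which vanish by
      \<open>row\<close>.\<close>
    have "(\<Sum>P\<in>insert (1\<^sub>m ?d) S. \<Sum>Q\<in>insert (1\<^sub>m ?d) S. a P * a Q * ?g P Q) =
        (\<Sum>Q\<in>insert (1\<^sub>m ?d) S. a Q * (\<Sum>P\<in>insert (1\<^sub>m ?d) S. a P * ?g P Q))"
      by (subst sum.swap) (simp only: sum_distrib_left mult_ac of_real_mult)
    also have "\<dots> = 0" by (intro sum.neutral ballI) (simp only: row mult_zero_right)
    finally have "(\<Sum>P\<in>insert (1\<^sub>m ?d) S. a P * (mat_trace (P * ket_bra \<psi>))\<^sup>2) = 0"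
      using S(3) ops pauli_ops_carrier pauli_ops_hermitian v(1)
      by (intro weighted_information_eq_0[where d = ?d]) blast+
    moreover have "mat_trace (1\<^sub>m ?d * ket_bra \<psi>) = 1"
      using mat_trace_ket_bra[OF one_carrier_mat v(1)] v by simp
    \<comment> \<open>The state has trace 1, so the identity contributes exactly its weight
      \<open>- q\<close>, and the rest must be \<open>q\<close>.\<close>
    ultimately have "- q + (\<Sum>P\<in>S. a P * (mat_trace (P * ket_bra \<psi>))\<^sup>2) = 0"
      using S by (simp add: a)
    moreover have "(\<Sum>P\<in>S. a P * (mat_trace (P * ket_bra \<psi>))\<^sup>2) = information S (ket_bra \<psi>)"
      unfolding information_def using S(2) by (intro sum.cong refl) (auto simp: a)
    ultimately show ?thesis by (simp add: q_def add_eq_0_iff)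
  qed
  have "disjoint_family_on (\<lambda>k. unsigned_nontrivial n (A k)) ?I"
    unfolding disjoint_family_on_def using disj[unfolded F_def] by blast
  moreover have "purity_invariant n S"
    unfolding purity_invariant_def using S(1) info by blast
  ultimately show ?thesis
    using info unfolding S_def F_def by blast
qed

end
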